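(* Let the game, the sets $X_i$, $\Theta$, the functions $f_i$, the communication graph, the functions $\hat{\mathbf F}$, $\hat F$, $\hat\chi_\Theta$, the constants $L_F$, $\xi>0$, and the optimal value $\hat{\mathbf F}^*$ be as in the context, with Assumptions 1, 2 and 3 listed there. Let $\{\theta_k\}$ be generated by the exact zeroth-order algorithm described in the context with constant stepsize $\alpha>0$. If $\alpha\le\frac{\xi}{2(nNL_F+1)}$, then for every integer $K\ge1$, $$\frac1K\sum_{k=0}^{K-1}\mathrm E\big[\|\nabla\hat{\mathbf F}(\theta_k)\|^2\big]\le\frac{2(\hat{\mathbf F}(\theta_0)-\hat{\mathbf F}^* )}{\alpha K}+2N^2n^2L_F^2\,\frac{nNL_F+1}{\xi}\,\alpha.$$
   Context: **Game.** There are $N$ players. Player $i\in[N]:=\{1,\dots,N\}$ chooses $x_i\in X_i\subseteq\mathbb R^{d_i}$; $d=\sum_i d_i$, $X=X_1\times\cdots\times X_N\subseteq\mathbb R^d$, $x=(x_i)_{i\in[N]}$, $x_{-i}=(x_j)_{j\ne i}$. Given a regulator decision $\theta\in\mathbb R^n$, player $i$ has real-valued cost $f_i(x_i,x_{-i},\theta)=f_i(x,\theta)$. A point $x(\theta)\in X$ is a Nash equilibrium (NE) for $\theta$ if $f_i(x_i(\theta),x_{-i}(\theta),\theta)\le f_i(x_i,x_{-i}(\theta),\theta)$ for all $x_i\in X_i$, $i\in[N]$. The pseudo-gradient is $G(x,\theta)=(\nabla_{x_i}f_i(x_i,x_{-i},\theta))_{i\in[N]}\in\mathbb R^d$. The regulator's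 feasible set is $\Theta\subseteq\mathbb R^n$. Norms are Euclidean. **Assumption 1.** (i) Each $X_i$ is nonempty, compact, convex. (ii) $\Theta$ is nonempty, closed, convex. (iii) For each $i$, $f_i(x_i,x_{-i},\theta)$ is continuously differentiable and convex in $x_i$ for any $x_{-i}\in\mathbb R^{d-d_i}$, $\theta\in\mathbb R^n$. (iv) There is $L_\theta>0$ with $|f_i(x,\theta)-f_i(x,\theta')|\le L_\theta\|\theta-\theta'\|$ for all $i$, $x\in X$, $\theta,\theta'\in\mathbb R^n$. Moreover there is a constant $L_x>0$ with $|f_i(x,\theta)-f_i(x',\theta)|\le L_x\|x-x'\|$ for all $i$, $x,x'\in X$, $\theta\in\mathbb R^n$. **Assumption 2.** (i) There are $\mu,l>0$ such that for all $\theta\in\mathbb R^n$, $x,x'\in\mathbb R^d$: $(G(x,\theta)-G(x',\theta))^\top(x-x')\ge\mu\|x-x'\|^2$ and $\|G(x,\theta)-G(x',\theta)\|\le l\|x-x'\|$. (ii) There is $l_\theta>0$ with $\|G(x,\theta)-G(x,\theta')\|\le l_\theta\|\theta-\theta'\|$ for all $x\in X$, $\theta,\theta'\in\mathbb R^n$. Under these assumptions the NE $x(\theta)$ exists and is unique for every $\theta\in\mathbb R^n$. **Assumption 3.** The players communicate over a strongly connected directed graph on $[N]$ with doubly stochastic adjacency matrix $\mathcal A=[a_{ij}]$, where $a_{ij}>0$ if $(j,i)$ is an edge or $i=j$, and $a_{ij}=0$ otherwise. (The graph plays no role in the exact algorithm.) **Objectives.** $F_i(\theta):=f_i(x(\theta),\theta)$,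 $F:=\sum_{i=1}^NF_i$. $L_F>0$ is a constant with $|F_i(\theta)-F_i(\theta')|\le L_F\|\theta-\theta'\|$ for all $i\in[N]$, $\theta,\theta'\in\mathbb R^n$. For a fixed smoothing parameter $\xi>0$: $\hat F(\theta):=\sum_{i=1}^N\mathrm E_\nu[F_i(\theta+\xi\nu)]$ with $\nu$ uniform on the closed unit ball of $\mathbb R^n$; $\hat\chi_\Theta(\theta):=\frac1{2\xi}\mathrm{dist}^2(\theta,\Theta)$, so $\nabla\hat\chi_\Theta(\theta)=\frac1\xi(\theta-\Pi_\Theta(\theta))$ with $\Pi_\Theta$ the Euclidean projection; $\hat{\mathbf F}:=\hat F+\hat\chi_\Theta$; $\hat{\mathbf F}^*:=\min_{\theta\in\mathbb R^n}\hat{\mathbf F}(\theta)$, which is assumed to exist. **Exact algorithm.** Start from a deterministic $\theta_0\in\Theta$. For $k=0,1,\dots,K-1$: draw $u_k$ uniformly from the unit sphere of $\mathbb R^n$, independently of the past; set $$\hat\nabla F(\theta_k)=\sum_{i=1}^N\frac n\xi\big(f_i(x(\theta_k+\xi u_k),\theta_k+\xi u_k)-f_i(x(\theta_k),\theta_k)\big)u_k,$$ $$\theta_{k+1}=\theta_k-\alpha\Big(\hat\nabla F(\theta_k)+\frac1\xi(\theta_k-\Pi_\Theta(\theta_k))\Big).$$ *)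

theory Defs
  imports "HOL-Probability.Probability" "Graph_Theory.Digraph_Component"
begin

definition gradient :: "('a::real_inner \<Rightarrow> real) \<Rightarrow> 'a \<Rightarrow> 'a" where
  "gradient h x = (THE D. GDERIV h x :> D)"


text \<open>
  The block dimensions may differ from player to player, so the joint decision space is
  \<open>real ^ 'd\<close> together with a map \<open>own :: 'd \<Rightarrow> 'p\<close> telling which player controls which
  coordinate. The decision space of player \<open>i\<close> is the coordinate subspace of vectors vanishing
  outside the block of \<open>i\<close>; it is isometric to the Euclidean space of dimension
  \<open>card {j. own j = i}\<close>.
\<close>

definition block_space :: "('d \<Rightarrow> 'p) \<Rightarrow> 'p \<Rightarrow> (real ^ 'd::finite) set" where
  "block_space own i = {v. \<forall>j. own j \<noteq> i \<longrightarrow> v $ j = 0}"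

text \<open>\<open>splice own i y x\<close> is the profile \<open>(y\<^sub>i, x\<^sub>-\<^sub>i)\<close>; it depends on \<open>y\<close> only through block \<open>i\<close>.\<close>

definition splice :: "('d \<Rightarrow> 'p) \<Rightarrow> 'p \<Rightarrow> real ^ 'd::finite \<Rightarrow> real ^ 'd \<Rightarrow> real ^ 'd" where
  "splice own i y x = (\<chi> j. if own j = i then y $ j else x $ j)"

definition profiles :: "('d \<Rightarrow> 'p) \<Rightarrow> ('p \<Rightarrow> (real ^ 'd::finite) set) \<Rightarrow> (real ^ 'd) set" where
  "profiles own X = {x. \<forall>i. splice own i x 0 \<in> X i}"

definition nash_equilibrium ::
  "('d \<Rightarrow> 'p) \<Rightarrow> ('p \<Rightarrow> (real ^ 'd::finite) set) \<Rightarrow> ('p \<Rightarrow> real ^ 'd \<Rightarrow> real ^ 'n::finite \<Rightarrow> real) \<Rightarrow>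
    real ^ 'n \<Rightarrow> real ^ 'd \<Rightarrow> bool" where
  "nash_equilibrium own X f \<theta> x \<longleftrightarrow>
     x \<in> profiles own X \<and> (\<forall>i. \<forall>y\<in>X i. f i x \<theta> \<le> f i (splice own i y x) \<theta>)"

definition NE ::
  "('d \<Rightarrow> 'p) \<Rightarrow> ('p \<Rightarrow> (real ^ 'd::finite) set) \<Rightarrow> ('p \<Rightarrow> real ^ 'd \<Rightarrow> real ^ 'n::finite \<Rightarrow> real) \<Rightarrow>
    real ^ 'n \<Rightarrow> real ^ 'd" where
  "NE own X f \<theta> = (THE x. nash_equilibrium own X f \<theta> x)"

text \<open>
  The partial gradient of \<open>f i\<close> in the decision of player \<open>i\<close> is the gradient of
  \<open>\<lambda>y. f i (splice own i y x) \<theta>\<close>. That function is constant in all coordinates outside block \<open>i\<close>,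
  so its gradient lies in the block space of \<open>i\<close>, and the pseudo-gradient collects, at
  coordinate \<open>j\<close>, the entry belonging to the owner of \<open>j\<close>.
\<close>

definition partial_grad ::
  "('d \<Rightarrow> 'p) \<Rightarrow> ('p \<Rightarrow> real ^ 'd::finite \<Rightarrow> real ^ 'n::finite \<Rightarrow> real) \<Rightarrow>
    'p \<Rightarrow> real ^ 'd \<Rightarrow> real ^ 'n \<Rightarrow> real ^ 'd" where
  "partial_grad own f i x \<theta> = gradient (\<lambda>y. f i (splice own i y x) \<theta>) x"

definition pseudo_grad ::
  "('d \<Rightarrow> 'p) \<Rightarrow> ('p \<Rightarrow> real ^ 'd::finite \<Rightarrow> real ^ 'n::finite \<Rightarrow> real) \<Rightarrow>
    real ^ 'd \<Rightarrow> real ^ 'n \<Rightarrow> real ^ 'd" where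
  "pseudo_grad own f x \<theta> = (\<chi> j. partial_grad own f (own j) x \<theta> $ j)"

definition cont_differentiable :: "('a::real_inner \<Rightarrow> real) \<Rightarrow> bool" where
  "cont_differentiable h \<longleftrightarrow>
     (\<forall>x. h differentiable (at x)) \<and> continuous_on UNIV (gradient h)"

definition assumption1 ::
  "('d \<Rightarrow> 'p::finite) \<Rightarrow> ('p \<Rightarrow> (real ^ 'd::finite) set) \<Rightarrow> (real ^ 'n::finite) set \<Rightarrow>
    ('p \<Rightarrow> real ^ 'd \<Rightarrow> real ^ 'n \<Rightarrow> real) \<Rightarrow> bool" where
  "assumption1 own X \<Theta> f \<longleftrightarrow>
     (\<forall>i. X i \<subseteq> block_space own i \<and> X i \<noteq> {} \<and> compact (X i) \<and> convex (X i)) \<and>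
     (\<Theta> \<noteq> {} \<and> closed \<Theta> \<and> convex \<Theta>) \<and>
     (\<forall>i x \<theta>. cont_differentiable (\<lambda>y. f i (splice own i y x) \<theta>) \<and>
               convex_on UNIV (\<lambda>y. f i (splice own i y x) \<theta>)) \<and>
     (\<exists>L\<theta>>0. \<forall>i. \<forall>x\<in>profiles own X. \<forall>\<theta> \<theta>'.
        \<bar>f i x \<theta> - f i x \<theta>'\<bar> \<le> L\<theta> * norm (\<theta> - \<theta>')) \<and>
     (\<exists>Lx>0. \<forall>i. \<forall>x\<in>profiles own X. \<forall>x'\<in>profiles own X. \<forall>\<theta>.
        \<bar>f i x \<theta> - f i x' \<theta>\<bar> \<le> Lx * norm (x - x'))"

definition assumption2 ::
  "('d \<Rightarrow> 'p::finite) \<Rightarrow> ('p \<Rightarrow> (real ^ 'd::finite) set) \<Rightarrow>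
    ('p \<Rightarrow> real ^ 'd \<Rightarrow> real ^ 'n::finite \<Rightarrow> real) \<Rightarrow> bool" where
  "assumption2 own X f \<longleftrightarrow>
     (\<exists>\<mu>>0. \<exists>l>0. \<forall>\<theta> x x'.
        (pseudo_grad own f x \<theta> - pseudo_grad own f x' \<theta>) \<bullet> (x - x') \<ge> \<mu> * (norm (x - x'))\<^sup>2 \<and>
        norm (pseudo_grad own f x \<theta> - pseudo_grad own f x' \<theta>) \<le> l * norm (x - x')) \<and>
     (\<exists>l\<theta>>0. \<forall>x\<in>profiles own X. \<forall>\<theta> \<theta>'.
        norm (pseudo_grad own f x \<theta> - pseudo_grad own f x \<theta>') \<le> l\<theta> * norm (\<theta> - \<theta>'))"

definition assumption3 :: "('p::finite) rel \<Rightarrow> real ^ 'p ^ 'p \<Rightarrow> bool" where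
  "assumption3 E A \<longleftrightarrow>
     strongly_connected (with_proj \<lparr>pverts = UNIV, parcs = E\<rparr>) \<and>
     (\<forall>i j. if (j, i) \<in> E \<or> i = j then A $ i $ j > 0 else A $ i $ j = 0) \<and>
     (\<forall>i. (\<Sum>j\<in>UNIV. A $ i $ j) = 1) \<and>
     (\<forall>j. (\<Sum>i\<in>UNIV. A $ i $ j) = 1)"

definition ne_cost ::
  "('d \<Rightarrow> 'p) \<Rightarrow> ('p \<Rightarrow> (real ^ 'd::finite) set) \<Rightarrow> ('p \<Rightarrow> real ^ 'd \<Rightarrow> real ^ 'n::finite \<Rightarrow> real) \<Rightarrow>
    'p \<Rightarrow> real ^ 'n \<Rightarrow> real" where
  "ne_cost own X f i \<theta> = f i (NE own X f \<theta>) \<theta>"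

definition uniform_ball :: "(real ^ 'n::finite) measure" where
  "uniform_ball = uniform_measure lborel (cball 0 1)"

text \<open>
  The uniform distribution on the unit sphere is the normalized cone measure: a set of directions
  has the probability of the part of the ball lying on rays through it. For the Euclidean norm
  this is the normalized surface measure, the unique rotation-invariant probability on the sphere.
\<close>

definition uniform_sphere :: "(real ^ 'n::finite) measure" where
  "uniform_sphere = distr uniform_ball borel (\<lambda>v. v /\<^sub>R norm v)"

definition smoothed_obj ::
  "real \<Rightarrow> ('p::finite \<Rightarrow> real ^ 'n::finite \<Rightarrow> real) \<Rightarrow> real ^ 'n \<Rightarrow> real" where
  "smoothed_obj \<xi> F \<theta> = (\<Sum>i\<in>UNIV. \<integral>\<nu>. F i (\<theta> + \<xi> *\<^sub>R \<nu>) \<partial>uniform_ball)"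

definition smoothed_indicator :: "real \<Rightarrow> (real ^ 'n::finite) set \<Rightarrow> real ^ 'n \<Rightarrow> real" where
  "smoothed_indicator \<xi> \<Theta> \<theta> = 1 / (2 * \<xi>) * (infdist \<theta> \<Theta>)\<^sup>2"

definition penalized_obj ::
  "real \<Rightarrow> (real ^ 'n::finite) set \<Rightarrow> ('p::finite \<Rightarrow> real ^ 'n \<Rightarrow> real) \<Rightarrow> real ^ 'n \<Rightarrow> real" where
  "penalized_obj \<xi> \<Theta> F \<theta> = smoothed_obj \<xi> F \<theta> + smoothed_indicator \<xi> \<Theta> \<theta>"

definition zo_grad ::
  "real \<Rightarrow> ('p::finite \<Rightarrow> real ^ 'n::finite \<Rightarrow> real) \<Rightarrow> real ^ 'n \<Rightarrow> real ^ 'n \<Rightarrow> real ^ 'n" where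
  "zo_grad \<xi> F \<theta> u =
     (\<Sum>i\<in>UNIV. (real CARD('n) / \<xi> * (F i (\<theta> + \<xi> *\<^sub>R u) - F i \<theta>)) *\<^sub>R u)"

primrec zo_iterate ::
  "real \<Rightarrow> real \<Rightarrow> (real ^ 'n::finite) set \<Rightarrow> ('p::finite \<Rightarrow> real ^ 'n \<Rightarrow> real) \<Rightarrow> real ^ 'n \<Rightarrow>
    (nat \<Rightarrow> real ^ 'n) \<Rightarrow> nat \<Rightarrow> real ^ 'n" where
  "zo_iterate \<alpha> \<xi> \<Theta> F \<theta>0 u 0 = \<theta>0"
| "zo_iterate \<alpha> \<xi> \<Theta> F \<theta>0 u (Suc k) =
     (let \<theta> = zo_iterate \<alpha> \<xi> \<Theta> F \<theta>0 u k
      in \<theta> - \<alpha> *\<^sub>R (zo_grad \<xi> F \<theta> (u k) + (1 / \<xi>) *\<^sub>R (\<theta> - closest_point \<Theta> \<theta>)))"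

end

theory Submission
  imports Defs "HOL-Real_Asymp.Real_Asymp"
begin

text \<open>
  The ball average of a Lipschitz function \<open>S\<close> with radius \<open>\<xi>\<close> is
  differentiable, with gradient \<open>n / \<xi>\<close> times the mean of \<open>S(x + \<xi>w) w\<close> over the unit sphere. In
  polar coordinates, for the cone measure on the sphere, the translated ball \<open>h + B\<close> is the star body
  with radial function \<open>w \<bullet> h + sqrt (1 - |h|\<^sup>2 + (w \<bullet> h)\<^sup>2) = 1 + w \<bullet> h + O(|h|\<^sup>2)\<close>, so integrating
  \<open>S\<close> over it and over \<open>B\<close> gives the first-order term directly. Applied to a constant function, this
  also shows that the sphere has mean zero, so that the two-point estimator is unbiased.

  The smoothed gradient is then Lipschitz with constant \<open>nNL\<^sub>F/\<xi>\<close> and the penalty gradient with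
  constant \<open>1/\<xi>\<close>. As the estimator has norm at most \<open>nNL\<^sub>F\<close>, the descent inequality in conditional
  expectation, followed by telescoping, yields the bound.
\<close>

section \<open>Polar coordinates\<close>

lemma ball_measure_pos: "0 < measure lborel (cball (0::'a::euclidean_space) 1)"
  using content_cball_pos[of 1 "0::'a"] by simp

lemma emeasure_unit_cball_eq:
  "emeasure lborel (cball (0::'a::euclidean_space) 1) = ennreal (measure lborel (cball (0::'a) 1))"
  by (rule emeasure_eq_ennreal_measure) (use emeasure_compact_finite[of "cball (0::'a) 1"] in \<open>auto simp: less_top\<close>)

lemma emeasure_unit_cball_neq_0: "emeasure lborel (cball (0::'a::euclidean_space) 1) \<noteq> 0"
  using ball_measure_pos[where 'a='a] by (simp add: emeasure_unit_cball_eq)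

lemma sets_uniform_ball [simp, measurable_cong]: "sets (uniform_ball :: (real ^ 'n::finite) measure) = sets borel"
  by (simp add: uniform_ball_def)

lemma sets_uniform_sphere [simp, measurable_cong]: "sets (uniform_sphere :: (real ^ 'n::finite) measure) = sets borel"
  by (simp add: uniform_sphere_def)

lemma space_uniform_sphere [simp]: "space (uniform_sphere :: (real ^ 'n::finite) measure) = UNIV"
  by (simp add: uniform_sphere_def)

lemma prob_space_uniform_ball: "prob_space (uniform_ball :: (real ^ 'n::finite) measure)"
  unfolding uniform_ball_def
  by (rule prob_space_uniform_measure) (simp_all add: emeasure_unit_cball_neq_0 emeasure_unit_cball_eq)

lemma prob_space_uniform_sphere: "prob_space (uniform_sphere :: (real ^ 'n::finite) measure)"
  unfolding uniform_sphere_def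
  by (rule prob_space.prob_space_distr[OF prob_space_uniform_ball]) simp

text \<open>The map \<open>v /\<^sub>R norm v\<close> sends 0 to 0, so the norm is 1 only off the
  null set that consists of the origin.\<close>

lemma AE_uniform_sphere: "AE w in (uniform_sphere :: (real ^ 'n::finite) measure). norm w = 1"
proof -
  have "AE v in (lborel :: (real ^ 'n) measure). v \<noteq> 0"
    by (rule AE_lborel_singleton)
  then have "AE v in (uniform_ball :: (real ^ 'n) measure). v \<noteq> 0"
    unfolding uniform_ball_def
    by (subst AE_uniform_measure) (auto simp: emeasure_unit_cball_neq_0 emeasure_unit_cball_eq[where 'a="real ^ 'n"])
  then show ?thesis
    unfolding uniform_sphere_def by (subst AE_distr_iff) (auto elim!: eventually_mono)
qed

lemma integral_uniform_ball:
  fixes g :: "real ^ 'n::finite \<Rightarrow> real"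
  assumes [measurable]: "g \<in> borel_measurable borel"
  shows "(\<integral>x. g x \<partial>uniform_ball) =
    (\<integral>x. indicator (cball 0 1) x * g x \<partial>lborel) / measure lborel (cball (0 :: real ^ 'n) 1)"
proof -
  let ?v = "measure lborel (cball (0 :: real ^ 'n) 1)"
  have v: "?v > 0" by (rule ball_measure_pos)
  have "indicator (cball 0 1) x / emeasure lborel (cball (0 :: real ^ 'n) 1) = ennreal (indicator (cball 0 1) x / ?v)"
    for x :: "real ^ 'n"
    unfolding emeasure_unit_cball_eq using v by (subst divide_ennreal[symmetric]) (auto simp: indicator_def)
  then have eq: "uniform_ball = density lborel (\<lambda>x :: real ^ 'n. ennreal (indicator (cball 0 1) x / ?v))"
    by (simp add: uniform_ball_def uniform_measure_def)
  have "(\<lambda>x::real ^ 'n. indicator (cball 0 1) x / ?v) \<in> borel_measurable lborel"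
    by (intro borel_measurable_divide borel_measurable_indicator borel_measurable_const) simp
  then have "(\<integral>x. g x \<partial>uniform_ball) = (\<integral>x. (indicator (cball 0 1) x / ?v) *\<^sub>R g x \<partial>lborel)"
    unfolding eq by (intro integral_density) (use v in auto)
  then show ?thesis by simp
qed

section \<open>Polar integration against the cone measure\<close>

lemma nn_integral_lborel_scaleR:
  fixes f :: "'a::euclidean_space \<Rightarrow> ennreal"
  assumes [measurable]: "f \<in> borel_measurable borel" and c: "c \<noteq> 0"
  shows "(\<integral>\<^sup>+x. f x \<partial>lborel) = ennreal (\<bar>c\<bar> ^ DIM('a)) * (\<integral>\<^sup>+x. f (c *\<^sub>R x) \<partial>lborel)"
  by (subst lborel_affine[OF c, of 0])
     (simp add: nn_integral_density nn_integral_distr nn_integral_cmult)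

text \<open>The antiderivative - 1 / t ^ n vanishes at infinity. With r = |x|, the value cancels the
  factor |x| ^ n that appears in \<open>nn_integral_polar\<close>.\<close>

lemma nn_integral_inverse_power:
  fixes r :: real
  assumes "r > 0" "n > 0"
  shows "(\<integral>\<^sup>+t. ennreal (real n / t ^ Suc n) * indicator {r..} t \<partial>lborel) = ennreal (1 / r ^ n)"
proof -
  have "(\<integral>\<^sup>+t. ennreal (real n / t ^ Suc n) * indicator {r..} t \<partial>lborel) = 0 - (- (1 / r ^ n))"
  proof (rule nn_integral_FTC_atLeast)
    show "((\<lambda>t. - (1 / t ^ n)) has_real_derivative real n / t ^ Suc n) (at t)" if "r \<le> t" for t
    proof -
      have "t > 0" using that assms by simp
      then have "((\<lambda>t. - (1 / t ^ n)) has_real_derivative (real n * t ^ (n - 1)) / (t ^ n)\<^sup>2) (at t)"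
        by (auto intro!: derivative_eq_intros simp: power2_eq_square)
      moreover have "(real n * t ^ (n - 1)) / (t ^ n)\<^sup>2 = real n / t ^ Suc n"
        using \<open>n > 0\<close> \<open>t > 0\<close> by (cases n) (auto simp: field_simps power2_eq_square)
      ultimately show ?thesis by simp
    qed
    show "((\<lambda>t::real. - (1 / t ^ n)) \<longlongrightarrow> 0) at_top"
      using \<open>n > 0\<close> by real_asymp
  qed (use assms in auto)
  then show ?thesis by simp
qed

text \<open>Unfolding the cone measure gives a double integral over x in the ball and r > 0.
  Substituting r = |x| t, exchanging the integrals and then substituting y = t x moves the ball
  constraint to t \<ge> |y|. After a second exchange, the integral over t equals |y| ^ (- n) and
  leaves f(y).\<close>

lemma nn_integral_polar:
  fixes f :: "real ^ 'n::finite \<Rightarrow> ennreal"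
  assumes [measurable]: "f \<in> borel_measurable borel"
  defines "v \<equiv> measure lborel (cball (0 :: real ^ 'n) 1)"
  shows "(\<integral>\<^sup>+x. f x \<partial>lborel) =
    (\<integral>\<^sup>+w. (\<integral>\<^sup>+r. f (r *\<^sub>R w) * (ennreal (v * (real CARD('n) * r ^ (CARD('n) - 1))) * indicator {0<..} r) \<partial>lborel) \<partial>uniform_sphere)"
proof -
  define n where "n = CARD('n)"
  have n: "n > 0" by (simp add: n_def)
  have v: "v > 0" unfolding v_def by (rule ball_measure_pos)
  have [measurable]: "cball (0 :: real ^ 'n) 1 \<in> sets borel" by simp
  let ?B = "cball (0 :: real ^ 'n) 1"
  let ?k = "\<lambda>r::real. ennreal (real n * r ^ (n - 1)) * indicator {0<..} r"
  have "(\<integral>\<^sup>+w. (\<integral>\<^sup>+r. f (r *\<^sub>R w) * (ennreal (v * (real n * r ^ (n - 1))) * indicator {0<..} r) \<partial>lborel) \<partial>uniform_sphere)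
     = (\<integral>\<^sup>+w. ennreal v * (\<integral>\<^sup>+r. f (r *\<^sub>R w) * ?k r \<partial>lborel) \<partial>uniform_sphere)"
    using v by (subst nn_integral_cmult[symmetric])
      (auto simp: ennreal_mult mult_ac indicator_def intro!: nn_integral_cong)
  also have "\<dots> = ennreal v * (\<integral>\<^sup>+w. (\<integral>\<^sup>+r. f (r *\<^sub>R w) * ?k r \<partial>lborel) \<partial>uniform_sphere)"
    by (subst nn_integral_cmult) (auto simp: uniform_sphere_def)
  \<comment> \<open>A direction drawn from the sphere is x / |x| with x uniform in the ball; the
    normalizing volume cancels against \<open>v\<close>.\<close>
  also have "\<dots> = ennreal v * ((\<integral>\<^sup>+x. (\<integral>\<^sup>+r. f (r *\<^sub>R (x /\<^sub>R norm x)) * ?k r \<partial>lborel) * indicator ?B x \<partial>lborel) / ennreal v)"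
    unfolding uniform_sphere_def uniform_ball_def v_def
    by (simp add: nn_integral_distr nn_integral_uniform_measure emeasure_unit_cball_eq)
  also have "\<dots> = (\<integral>\<^sup>+x. (\<integral>\<^sup>+r. f (r *\<^sub>R (x /\<^sub>R norm x)) * ?k r \<partial>lborel) * indicator ?B x \<partial>lborel)"
    using v by (simp only: ennreal_times_divide mult.commute[of "ennreal v"]) (subst ennreal_mult_divide_eq, auto)
  \<comment> \<open>Substitution r = |x| t for x \<noteq> 0: one factor |x| comes from dr and n - 1
    factors from the radial weight.\<close>
  also have "\<dots> = (\<integral>\<^sup>+x. (\<integral>\<^sup>+t. f (t *\<^sub>R x) * ?k t * (ennreal (norm x ^ n) * indicator ?B x) \<partial>lborel) \<partial>lborel)"
  proof (rule nn_integral_cong_AE)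
    have "AE x in (lborel :: (real ^ 'n) measure). x \<noteq> 0"
      by (rule AE_lborel_singleton)
    then show "AE x in lborel. (\<integral>\<^sup>+r. f (r *\<^sub>R (x /\<^sub>R norm x)) * ?k r \<partial>lborel) * indicator ?B x =
       (\<integral>\<^sup>+t. f (t *\<^sub>R x) * ?k t * (ennreal (norm x ^ n) * indicator ?B x) \<partial>lborel)"
    proof eventually_elim
      case (elim x)
      have eq: "(norm x * t) *\<^sub>R (x /\<^sub>R norm x) = t *\<^sub>R x" for t
        using elim by simp
      have "(\<integral>\<^sup>+r. f (r *\<^sub>R (x /\<^sub>R norm x)) * ?k r \<partial>lborel)
          = ennreal (norm x) * (\<integral>\<^sup>+t. f (t *\<^sub>R x) * ?k (norm x * t) \<partial>lborel)"
        using elim by (subst nn_integral_real_affine[where c="norm x" and t=0]) (auto simp: eq simp del: scaleR_scaleR)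
      also have "\<dots> = (\<integral>\<^sup>+t. ennreal (norm x) * (f (t *\<^sub>R x) * ?k (norm x * t)) \<partial>lborel)"
        by (simp add: nn_integral_cmult)
      also have "\<dots> = (\<integral>\<^sup>+t. f (t *\<^sub>R x) * ?k t * ennreal (norm x ^ n) \<partial>lborel)"
      proof (rule nn_integral_cong)
        fix t
        have "norm x * (real n * (norm x * t) ^ (n - 1)) = real n * t ^ (n - 1) * norm x ^ n"
          using n by (cases n) (auto simp: power_mult_distrib)
        then have "t > 0 \<Longrightarrow> ennreal (norm x) * ennreal (real n * (norm x * t) ^ (n - 1)) = ennreal (real n * t ^ (n - 1)) * ennreal (norm x ^ n)"
          by (subst (1 2) ennreal_mult[symmetric]) auto
        then show "ennreal (norm x) * (f (t *\<^sub>R x) * ?k (norm x * t)) = f (t *\<^sub>R x) * ?k t * ennreal (norm x ^ n)"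
          using elim mult.left_commute[of "ennreal (norm x)" "f (t *\<^sub>R x)"]
          by (auto simp: indicator_def zero_less_mult_iff mult.assoc)
      qed
      finally have "(\<integral>\<^sup>+r. f (r *\<^sub>R (x /\<^sub>R norm x)) * ?k r \<partial>lborel) * indicator ?B x
          = (\<integral>\<^sup>+t. f (t *\<^sub>R x) * ?k t * ennreal (norm x ^ n) \<partial>lborel) * indicator ?B x"
        by (rule arg_cong)
      also have "\<dots> = (\<integral>\<^sup>+t. f (t *\<^sub>R x) * ?k t * ennreal (norm x ^ n) * indicator ?B x \<partial>lborel)"
        by (rule nn_integral_multc[symmetric]) measurable
      finally show ?case by (simp only: mult.assoc)
    qed
  qed
  also have "\<dots> = (\<integral>\<^sup>+t. (\<integral>\<^sup>+x. f (t *\<^sub>R x) * ?k t * (ennreal (norm x ^ n) * indicator ?B x) \<partial>lborel) \<partial>lborel)"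
    by (rule lborel_pair.Fubini') measurable
  \<comment> \<open>Rescaling of x by t: the Jacobian and |x| ^ n each contribute t ^ (- n), and |x|
    \<le> 1 becomes |x| \<le> t. Written as an indicator of \<open>t - norm x\<close>, this
    constraint is jointly measurable in both variables, as the next exchange requires.\<close>
  also have "\<dots> = (\<integral>\<^sup>+t. (\<integral>\<^sup>+x. f x * ennreal (norm x ^ n) * (ennreal (real n / t ^ Suc n) * indicator {0..} (t - norm x) * indicator {0<..} t) \<partial>lborel) \<partial>lborel)"
  proof (rule nn_integral_cong)
    fix t :: real
    show "(\<integral>\<^sup>+x. f (t *\<^sub>R x) * ?k t * (ennreal (norm x ^ n) * indicator ?B x) \<partial>lborel) =
       (\<integral>\<^sup>+x. f x * ennreal (norm x ^ n) * (ennreal (real n / t ^ Suc n) * indicator {0..} (t - norm x) * indicator {0<..} t) \<partial>lborel)"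
    proof (cases "t > 0")
      case True
      have "ennreal (t ^ n) * (f (t *\<^sub>R x) * ennreal (norm (t *\<^sub>R x) ^ n) * (ennreal (real n / t ^ Suc n) * indicator {0..} (t - norm (t *\<^sub>R x)) * indicator {0<..} t))
        = f (t *\<^sub>R x) * ?k t * (ennreal (norm x ^ n) * indicator ?B x)" for x :: "real ^ 'n"
      proof -
        have "t ^ n * ((norm (t *\<^sub>R x) ^ n) * (real n / t ^ Suc n)) = real n * t ^ (n - 1) * norm x ^ n"
          using True n by (cases n) (auto simp: power_mult_distrib field_simps)
        then have "ennreal (t ^ n) * (ennreal (norm (t *\<^sub>R x) ^ n) * ennreal (real n / t ^ Suc n)) = ennreal (real n * t ^ (n - 1)) * ennreal (norm x ^ n)"
          using True by (simp add: ennreal_mult[symmetric])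
        then show ?thesis
          using True mult.left_commute[of "ennreal (t ^ n)" "f (t *\<^sub>R x)"]
          by (auto simp: indicator_def mult.assoc)
      qed
      note eq = this
      let ?g = "\<lambda>x. f x * ennreal (norm x ^ n) * (ennreal (real n / t ^ Suc n) * indicator {0..} (t - norm x) * indicator {0<..} t)"
      have gm: "?g \<in> borel_measurable borel" by measurable
      have "(\<integral>\<^sup>+x. f (t *\<^sub>R x) * ?k t * (ennreal (norm x ^ n) * indicator ?B x) \<partial>lborel)
        = (\<integral>\<^sup>+x. ennreal (t ^ n) * ?g (t *\<^sub>R x) \<partial>lborel)"
        by (simp only: eq)
      also have "\<dots> = ennreal (t ^ n) * (\<integral>\<^sup>+x. ?g (t *\<^sub>R x) \<partial>lborel)"
        by (rule nn_integral_cmult) (use gm in measurable)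
      also have "\<dots> = (\<integral>\<^sup>+x. ?g x \<partial>lborel)"
        using True by (subst nn_integral_lborel_scaleR[where f="?g" and c=t, OF gm]) (auto simp: n_def)
      finally show ?thesis .
    qed simp
  qed
  also have "\<dots> = (\<integral>\<^sup>+x. (\<integral>\<^sup>+t. f x * ennreal (norm x ^ n) * (ennreal (real n / t ^ Suc n) * indicator {0..} (t - norm x) * indicator {0<..} t) \<partial>lborel) \<partial>lborel)"
    by (rule lborel_pair.Fubini'[symmetric]) measurable
  also have "\<dots> = (\<integral>\<^sup>+x. f x \<partial>lborel)"
  proof (rule nn_integral_cong_AE)
    have "AE x in (lborel :: (real ^ 'n) measure). x \<noteq> 0"
      by (rule AE_lborel_singleton)
    then show "AE x in lborel. (\<integral>\<^sup>+t. f x * ennreal (norm x ^ n) * (ennreal (real n / t ^ Suc n) * indicator {0..} (t - norm x) * indicator {0<..} t) \<partial>lborel) = f x"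
    proof eventually_elim
      case (elim x)
      have pos: "norm x \<le> t \<Longrightarrow> 0 < t" for t
        using elim less_le_trans[of 0 "norm x" t] by simp
      have "(\<integral>\<^sup>+t. f x * ennreal (norm x ^ n) * (ennreal (real n / t ^ Suc n) * indicator {0..} (t - norm x) * indicator {0<..} t) \<partial>lborel)
        = f x * ennreal (norm x ^ n) * (\<integral>\<^sup>+t. ennreal (real n / t ^ Suc n) * indicator {norm x..} t \<partial>lborel)"
        using pos by (subst nn_integral_cmult[symmetric])
           (auto intro!: nn_integral_cong simp: indicator_def)
      also have "\<dots> = f x * (ennreal (norm x ^ n) * ennreal (1 / norm x ^ n))"
        using elim n nn_integral_inverse_power[of "norm x" n] by (simp add: mult.assoc)
      also have "\<dots> = f x"
        using elim by (simp add: ennreal_mult[symmetric])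
      finally show ?case .
    qed
  qed
  finally show ?thesis by (simp add: n_def)
qed

text \<open>The type argument carries the dimension, which the real number \<open>r\<close> does not
  determine. The volume factor is present because \<open>uniform_sphere\<close> has mass 1: n times
  the ball volume is the area of the sphere.\<close>

definition radial_density :: "'n::finite itself \<Rightarrow> real \<Rightarrow> real" where
  "radial_density _ r = measure lborel (cball (0 :: real ^ 'n) 1) * (real CARD('n) * r ^ (CARD('n) - 1)) * indicator {0<..} r"

lemma radial_density_nonneg: "0 \<le> radial_density TYPE('n::finite) r"
  by (simp add: radial_density_def indicator_def)

lemma radial_density_measurable [measurable]: "radial_density TYPE('n::finite) \<in> borel_measurable borel"
  unfolding radial_density_def[abs_def] by measurable

lemma sigma_finite_radial: "sigma_finite_measure (density lborel (radial_density TYPE('n::finite)))"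
  by (subst sigma_finite_measure.sigma_finite_iff_density_finite[OF sigma_finite_lborel]) auto

text \<open>Turns the formula for nonnegative functions into an identity of measures, from which
  Bochner integrals of signed functions follow by Fubini.\<close>

lemma lborel_polar:
  "lborel = distr ((uniform_sphere :: (real ^ 'n::finite) measure) \<Otimes>\<^sub>M density lborel (radial_density TYPE('n)))
     borel (\<lambda>(w, r). r *\<^sub>R w)"
proof (rule measure_eqI)
  interpret R: sigma_finite_measure "density lborel (radial_density TYPE('n))"
    by (rule sigma_finite_radial)
  fix A :: "(real ^ 'n) set"
  assume "A \<in> sets lborel"
  then have [measurable]: "A \<in> sets borel" by simp
  have "emeasure lborel A = (\<integral>\<^sup>+x. indicator A x \<partial>lborel)" by simp
  also have "\<dots> = (\<integral>\<^sup>+w. (\<integral>\<^sup>+r. ennreal (radial_density TYPE('n) r) * indicator A (r *\<^sub>R w) \<partial>lborel) \<partial>uniform_sphere)"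
    by (subst nn_integral_polar)
       (auto intro!: nn_integral_cong simp: radial_density_def indicator_def mult_ac)
  also have "\<dots> = (\<integral>\<^sup>+w. (\<integral>\<^sup>+r. indicator A (r *\<^sub>R w) \<partial>density lborel (radial_density TYPE('n))) \<partial>uniform_sphere)"
    by (subst nn_integral_density) auto
  also have "\<dots> = (\<integral>\<^sup>+p. indicator A (snd p *\<^sub>R fst p) \<partial>(uniform_sphere \<Otimes>\<^sub>M density lborel (radial_density TYPE('n))))"
    by (subst R.nn_integral_fst[symmetric]) auto
  also have "\<dots> = (\<integral>\<^sup>+x. indicator A x \<partial>distr (uniform_sphere \<Otimes>\<^sub>M density lborel (radial_density TYPE('n))) borel (\<lambda>(w, r). r *\<^sub>R w))"
    by (subst nn_integral_distr) (auto simp: case_prod_beta)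
  finally show "emeasure lborel A = emeasure (distr (uniform_sphere \<Otimes>\<^sub>M density lborel (radial_density TYPE('n))) borel (\<lambda>(w, r). r *\<^sub>R w)) A"
    by simp
qed simp

lemma integral_polar:
  fixes G :: "real ^ 'n::finite \<Rightarrow> real"
  assumes G: "integrable lborel G"
  shows "integrable uniform_sphere (\<lambda>w. \<integral>r. radial_density TYPE('n) r * G (r *\<^sub>R w) \<partial>lborel)" (is ?A)
    and "(\<integral>x. G x \<partial>lborel) = (\<integral>w. (\<integral>r. radial_density TYPE('n) r * G (r *\<^sub>R w) \<partial>lborel) \<partial>uniform_sphere)" (is ?B)
proof -
  interpret R: sigma_finite_measure "density lborel (radial_density TYPE('n))"
    by (rule sigma_finite_radial)
  interpret S: prob_space "uniform_sphere :: (real ^ 'n) measure"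
    by (rule prob_space_uniform_sphere)
  interpret P: pair_sigma_finite "uniform_sphere :: (real ^ 'n) measure" "density lborel (radial_density TYPE('n))" ..
  have [measurable]: "G \<in> borel_measurable borel"
    using G by (simp add: integrable_iff_bounded)
  let ?P = "uniform_sphere \<Otimes>\<^sub>M density lborel (radial_density TYPE('n))"
  have "integrable (distr ?P borel (\<lambda>(w, r). r *\<^sub>R w)) G"
    using G lborel_polar by metis
  then have int: "integrable ?P (\<lambda>(w, r). G (r *\<^sub>R w))"
    by (subst (asm) integrable_distr_eq) (simp_all add: case_prod_beta')
  have eq: "(\<integral>r. G (r *\<^sub>R w) \<partial>density lborel (radial_density TYPE('n))) = (\<integral>r. radial_density TYPE('n) r * G (r *\<^sub>R w) \<partial>lborel)"
    for w by (subst integral_density) (auto simp: radial_density_nonneg)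
  have "(\<integral>x. G x \<partial>lborel) = integral\<^sup>L (distr ?P borel (\<lambda>(w, r). r *\<^sub>R w)) G"
    using lborel_polar by metis
  also have "\<dots> = (\<integral>p. (\<lambda>(w, r). G (r *\<^sub>R w)) p \<partial>?P)"
    by (subst integral_distr) (simp_all add: case_prod_beta')
  also have "\<dots> = (\<integral>w. (\<integral>r. G (r *\<^sub>R w) \<partial>density lborel (radial_density TYPE('n))) \<partial>uniform_sphere)"
    using P.integral_fst[OF int] by simp
  finally show ?B by (simp only: eq)
  show ?A using P.integrable_fst[OF int] by (simp only: eq)
qed

section \<open>Estimates along a ray through the translated ball\<close>

lemma abs_power_minus_one_le:
  fixes r :: real
  assumes "0 \<le> r" "r \<le> 2"
  shows "\<bar>r ^ m - 1\<bar> \<le> 3 ^ m * \<bar>r - 1\<bar>"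
proof (induction m)
  case (Suc m)
  have "r ^ Suc m - 1 = r * (r ^ m - 1) + (r - 1)" by (simp add: algebra_simps)
  also have "\<bar>\<dots>\<bar> \<le> \<bar>r\<bar> * \<bar>r ^ m - 1\<bar> + \<bar>r - 1\<bar>"
    by (metis abs_mult abs_triangle_ineq)
  \<comment> \<open>The exact recursion for the constants is c to 2 * c + 1; enlarging 1 to 3 ^ m
    closes it at 3 ^ (m + 1).\<close>
  also have "\<dots> \<le> 2 * (3 ^ m * \<bar>r - 1\<bar>) + 3 ^ m * \<bar>r - 1\<bar>"
    using assms Suc by (intro add_mono mult_mono) (auto simp: mult_le_cancel_right1)
  finally show ?case by (simp add: mult_ac)
qed simp

text \<open>The unit ball centred at \<open>h\<close> is star-shaped with respect to \<open>0\<close>; this is its radial function.\<close>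

definition ball_radius :: "'a::real_inner \<Rightarrow> 'a \<Rightarrow> real" where
  "ball_radius h w = w \<bullet> h + sqrt (1 - (norm h)\<^sup>2 + (w \<bullet> h)\<^sup>2)"

text \<open>The condition |r w - h| \<le> 1 is a quadratic inequality in r. Since |h| < 1, the
  square root exceeds |w \<bullet> h|, so the smaller root is negative and only the larger one
  constrains r > 0.\<close>

lemma scaleR_in_cball_iff:
  fixes h w :: "'a::real_inner"
  assumes w: "norm w = 1" and h: "norm h < 1" and r: "r > 0"
  shows "r *\<^sub>R w \<in> cball h 1 \<longleftrightarrow> r \<le> ball_radius h w"
proof -
  let ?q = "1 - (norm h)\<^sup>2 + (w \<bullet> h)\<^sup>2"
  have q: "?q > (w \<bullet> h)\<^sup>2" using h by (simp add: power_less_one_iff abs_square_less_1)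
  then have sq: "sqrt ?q > \<bar>w \<bullet> h\<bar>" by (intro real_less_rsqrt) simp
  have "r *\<^sub>R w \<in> cball h 1 \<longleftrightarrow> (norm (r *\<^sub>R w - h))\<^sup>2 \<le> 1"
    by (simp add: dist_norm norm_minus_commute abs_square_le_1)
  also have "(norm (r *\<^sub>R w - h))\<^sup>2 = r\<^sup>2 - 2 * r * (w \<bullet> h) + (norm h)\<^sup>2"
    using w unfolding power2_norm_eq_inner norm_eq_1
    by (simp add: inner_diff inner_commute power2_eq_square algebra_simps)
  also have "\<dots> \<le> 1 \<longleftrightarrow> (r - w \<bullet> h)\<^sup>2 \<le> ?q"
    by (simp add: power2_eq_square algebra_simps)
  also have "\<dots> \<longleftrightarrow> \<bar>r - w \<bullet> h\<bar> \<le> sqrt ?q"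
    using real_sqrt_le_iff[of "(r - w \<bullet> h)\<^sup>2" ?q] by simp
  also have "\<dots> \<longleftrightarrow> r - w \<bullet> h \<le> sqrt ?q"
    using sq r by (auto simp: abs_le_iff)
  finally show ?thesis by (auto simp: ball_radius_def)
qed

text \<open>The radicand lies between (1 - |h|^2)^2 and 1, hence its root between 1 - |h|^2 and 1.
  The bound |h| \<le> 1/2 then keeps the radius in [0, 2].\<close>

lemma ball_radius_bounds:
  fixes h w :: "'a::real_inner"
  assumes w: "norm w = 1" and h: "norm h \<le> 1 / 2"
  shows "\<bar>ball_radius h w - 1 - w \<bullet> h\<bar> \<le> (norm h)\<^sup>2" and "\<bar>ball_radius h w - 1\<bar> \<le> 2 * norm h"
    and "0 \<le> ball_radius h w" and "ball_radius h w \<le> 2"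
proof -
  let ?q = "1 - (norm h)\<^sup>2 + (w \<bullet> h)\<^sup>2"
  have wh: "\<bar>w \<bullet> h\<bar> \<le> norm h" using Cauchy_Schwarz_ineq2[of w h] w by simp
  then have "(w \<bullet> h)\<^sup>2 \<le> (norm h)\<^sup>2" by (simp add: abs_le_square_iff[symmetric])
  then have q1: "?q \<le> 1" by simp
  have hh: "(norm h)\<^sup>2 \<le> norm h / 2" using h mult_left_mono[OF h, of "norm h"] by (simp add: power2_eq_square)
  have "(norm h)\<^sup>2 \<le> 1 / 4" using hh h by simp
  then have q0: "0 \<le> 1 - (norm h)\<^sup>2" by simp
  have "(1 - (norm h)\<^sup>2)\<^sup>2 \<le> 1 - (norm h)\<^sup>2"
    using q0 mult_left_mono[of "1 - (norm h)\<^sup>2" 1 "1 - (norm h)\<^sup>2"] by (simp add: power2_eq_square)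
  also have "\<dots> \<le> ?q" by simp
  finally have s1: "1 - (norm h)\<^sup>2 \<le> sqrt ?q" by (rule real_le_rsqrt)
  have s2: "sqrt ?q \<le> 1" using q1 by simp
  show b: "\<bar>ball_radius h w - 1 - w \<bullet> h\<bar> \<le> (norm h)\<^sup>2"
    using s1 s2 by (auto simp: ball_radius_def abs_le_iff)
  show c: "\<bar>ball_radius h w - 1\<bar> \<le> 2 * norm h" using b wh hh by linarith
  show "0 \<le> ball_radius h w" "ball_radius h w \<le> 2" using c h by linarith+
qed

text \<open>The function \<open>q\<close> below has derivative H - H(1), which is at most C |R - 1|
  in absolute value on the segment between 1 and R. The mean value inequality gives the square,
  whichever side of 1 contains R.\<close>

lemma integral_linear_approx:
  fixes H :: "real \<Rightarrow> real"
  assumes cont: "continuous_on {0..2} H" and H: "\<And>r. 0 \<le> r \<Longrightarrow> r \<le> 2 \<Longrightarrow> \<bar>H r - H 1\<bar> \<le> C * \<bar>r - 1\<bar>"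
    and R: "0 \<le> R" "R \<le> 2"
  shows "\<bar>integral {0..R} H - integral {0..1} H - H 1 * (R - 1)\<bar> \<le> C * (R - 1)\<^sup>2"
proof -
  have C: "0 \<le> C" using H[of 0] by simp
  define q where "q x = integral {0..x} H - H 1 * x" for x
  have "norm (q R - q 1) \<le> (C * \<bar>R - 1\<bar>) * norm (R - 1)"
  proof (rule field_differentiable_bound[where S="closed_segment 1 R" and f'="\<lambda>x. H x - H 1"])
    fix z assume "z \<in> closed_segment 1 R"
    then have z: "0 \<le> z" "z \<le> 2" "\<bar>z - 1\<bar> \<le> \<bar>R - 1\<bar>"
      using R by (auto simp: closed_segment_eq_real_ivl split: if_splits)
    have sub: "closed_segment 1 R \<subseteq> {0..2}"
      using R by (auto simp: closed_segment_eq_real_ivl)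
    show "(q has_real_derivative H z - H 1) (at z within closed_segment 1 R)"
      unfolding q_def using z
      by (auto intro!: derivative_eq_intros DERIV_subset[OF integral_has_real_derivative[OF cont] sub])
    show "norm (H z - H 1) \<le> C * \<bar>R - 1\<bar>"
      using H[OF z(1,2)] mult_left_mono[OF z(3) C] by simp
  qed auto
  then show ?thesis by (simp add: q_def algebra_simps power2_eq_square abs_mult_self_eq flip: abs_mult)
qed

section \<open>The gradient of a ball average\<close>

lemma integrable_indicator_compact:
  fixes G :: "'a::euclidean_space \<Rightarrow> real"
  assumes "continuous_on UNIV G" "compact S"
  shows "integrable lborel (\<lambda>x. indicator S x * G x)"
  using borel_integrable_compact[of S G] continuous_on_subset[OF assms(1)] assms(2)
  by (simp add: mult.commute indicator_scaleR_eq_if[symmetric] indicator_def if_distrib cong: if_cong)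

text \<open>A continuous function is bounded on the compact set. This serves the uniform
  distributions and, later, the iterates.\<close>

lemma (in prob_space) integrable_continuous_AE_compact:
  fixes g :: "'b::{second_countable_topology, t2_space} \<Rightarrow> 'c::euclidean_space"
  assumes g: "continuous_on UNIV g" and S: "compact S" "AE x in M. f x \<in> S" and f: "f \<in> borel_measurable M"
  shows "integrable M (\<lambda>x. g (f x))"
proof -
  have "compact (g ` S)"
    using continuous_on_subset[OF g subset_UNIV] S(1) by (rule compact_continuous_image)
  from compact_imp_bounded[OF this] obtain b where b: "\<And>x. x \<in> S \<Longrightarrow> norm (g x) \<le> b"
    unfolding bounded_iff by blast
  show ?thesis
  proof (rule integrable_const_bound)
    show "AE x in M. norm (g (f x)) \<le> b"
      using S(2) by eventually_elim (rule b)
    show "(\<lambda>x. g (f x)) \<in> borel_measurable M"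
      using measurable_compose[OF f borel_measurable_continuous_onI[OF g]] .
  qed
qed

lemma uniform_sphere_integrable:
  fixes g :: "real ^ 'n::finite \<Rightarrow> 'b::euclidean_space"
  assumes "continuous_on UNIV g"
  shows "integrable uniform_sphere g"
proof (rule prob_space.integrable_continuous_AE_compact[OF prob_space_uniform_sphere assms compact_sphere])
  show "AE x in (uniform_sphere :: (real ^ 'n) measure). x \<in> sphere 0 1"
    using AE_uniform_sphere by simp
qed simp

lemma uniform_ball_integrable:
  fixes g :: "real ^ 'n::finite \<Rightarrow> 'b::euclidean_space"
  assumes "continuous_on UNIV g"
  shows "integrable uniform_ball g"
proof (rule prob_space.integrable_continuous_AE_compact[OF prob_space_uniform_ball assms compact_cball])
  show "AE x in (uniform_ball :: (real ^ 'n) measure). x \<in> cball 0 1"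
    unfolding uniform_ball_def by (rule AE_uniform_measureI) auto
qed simp

text \<open>Along the ray of w, \<open>J h\<close> is v n times the integral of r ^ (n - 1) G(r w)
  from 0 to the radius R of the translated ball, and h = 0 has R = 1; the integral is linearized in
  R at 1. In the constant, the inner sum is the Lipschitz-type constant of the integrand about 1 on
  [0, 2], the factor 4 comes from (R - 1)^2 \<le> 4 |h|^2, and the last summand from replacing R - 1
  by w \<bullet> h.\<close>

lemma radial_integral_estimate:
  fixes G :: "real ^ 'n::finite \<Rightarrow> real"
  assumes lip: "\<And>x y. \<bar>G x - G y\<bar> \<le> L * norm (x - y)"
    and w: "norm w = 1" and h: "norm h \<le> 1 / 2"
  defines "v \<equiv> measure lborel (cball (0 :: real ^ 'n) 1)" and "n \<equiv> CARD('n)"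
  defines "J \<equiv> \<lambda>h. \<integral>r. radial_density TYPE('n) r * (indicator (cball h 1) (r *\<^sub>R w) * G (r *\<^sub>R w)) \<partial>lborel"
  shows "\<bar>J h - J 0 - v * real n * (G w * (w \<bullet> h))\<bar>
    \<le> v * real n * (4 * (2 ^ (n - 1) * L + (\<bar>G 0\<bar> + L) * 3 ^ (n - 1)) + (\<bar>G 0\<bar> + L)) * (norm h)\<^sup>2"
proof -
  have v: "v > 0" unfolding v_def by (rule ball_measure_pos)
  have L: "L \<ge> 0" using order_trans[OF abs_ge_zero lip[of w 0]] w by simp
  define H where "H r = r ^ (n - 1) * G (r *\<^sub>R w)" for r
  have contG: "continuous_on UNIV G"
    by (rule lipschitz_on_continuous_on[of L]) (use L lip in \<open>auto simp: lipschitz_on_def dist_norm\<close>)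
  have contH: "continuous_on A H" for A
    unfolding H_def by (intro continuous_intros continuous_on_compose2[OF contG]) auto
  have Jeq: "J h = v * real n * integral {0..ball_radius h w} H" if h: "norm h \<le> 1 / 2" for h
  proof -
    have "J h = (\<integral>r. v * real n * (indicator {0..ball_radius h w} r *\<^sub>R H r) \<partial>lborel)"
      unfolding J_def
    proof (rule integral_cong_AE)
      \<comment> \<open>At r = 0 the radial density vanishes while \<open>H\<close> need not, for
        instance in dimension one; this point is discarded as a null set.\<close>
      show "AE r in lborel. radial_density TYPE('n) r * (indicator (cball h 1) (r *\<^sub>R w) * G (r *\<^sub>R w))
          = v * real n * (indicator {0..ball_radius h w} r *\<^sub>R H r)"
        using AE_lborel_singleton[of 0]
      proof eventually_elim
        case (elim r)
        then show ?case
          using scaleR_in_cball_iff[OF w, of h r] h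
          by (auto simp: radial_density_def H_def v_def n_def indicator_def)
      qed
      have [measurable]: "G \<in> borel_measurable borel" "H \<in> borel_measurable borel" "cball h 1 \<in> sets borel"
        using contG contH by (auto intro: borel_measurable_continuous_onI)
      show "(\<lambda>r. radial_density TYPE('n) r * (indicator (cball h 1) (r *\<^sub>R w) * G (r *\<^sub>R w))) \<in> borel_measurable lborel"
        "(\<lambda>r. v * real n * (indicator {0..ball_radius h w} r *\<^sub>R H r)) \<in> borel_measurable lborel"
        by measurable
    qed
    also have "\<dots> = v * real n * (LINT r:{0..ball_radius h w}|lborel. H r)"
      by (simp add: set_lebesgue_integral_def)
    also have "(LINT r:{0..ball_radius h w}|lborel. H r) = integral {0..ball_radius h w} H"
      by (rule set_borel_integral_eq_integral(2)) (rule borel_integrable_atLeastAtMost', rule contH)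
    finally show ?thesis .
  qed
  define R where "R = ball_radius h w"
  note Rb = ball_radius_bounds[OF w h, folded R_def]
  have R0: "ball_radius 0 w = 1" by (simp add: ball_radius_def)
  let ?M = "\<bar>G 0\<bar> + L"
  let ?C = "2 ^ (n - 1) * L + ?M * 3 ^ (n - 1)"
  have Gw: "\<bar>G w\<bar> \<le> ?M" using lip[of w 0] w by simp
  have H1: "H 1 = G w" by (simp add: H_def)
  have est: "\<bar>H r - H 1\<bar> \<le> ?C * \<bar>r - 1\<bar>" if r: "0 \<le> r" "r \<le> 2" for r
  proof -
    have "H r - H 1 = r ^ (n - 1) * (G (r *\<^sub>R w) - G w) + G w * (r ^ (n - 1) - 1)"
      by (simp add: H_def algebra_simps)
    also have "\<bar>\<dots>\<bar> \<le> \<bar>r ^ (n - 1)\<bar> * \<bar>G (r *\<^sub>R w) - G w\<bar> + \<bar>G w\<bar> * \<bar>r ^ (n - 1) - 1\<bar>"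
      by (metis abs_mult abs_triangle_ineq)
    also have "\<dots> \<le> 2 ^ (n - 1) * (L * \<bar>r - 1\<bar>) + ?M * (3 ^ (n - 1) * \<bar>r - 1\<bar>)"
    proof (intro add_mono mult_mono)
      have "norm (r *\<^sub>R w - w) = \<bar>r - 1\<bar>"
        using w by (metis norm_scaleR mult.right_neutral scaleR_diff_left scaleR_one)
      then show "\<bar>G (r *\<^sub>R w) - G w\<bar> \<le> L * \<bar>r - 1\<bar>" using lip[of "r *\<^sub>R w" w] by simp
    qed (use r L Gw abs_power_minus_one_le[OF r] in \<open>auto intro: power_mono\<close>)
    finally show ?thesis by (simp add: algebra_simps)
  qed
  have main: "\<bar>integral {0..R} H - integral {0..1} H - H 1 * (R - 1)\<bar> \<le> ?C * (R - 1)\<^sup>2"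
    by (rule integral_linear_approx[OF contH est Rb(3,4)])
  have "(R - 1)\<^sup>2 \<le> (2 * norm h)\<^sup>2" using power_mono[OF Rb(2), of 2] by simp
  then have sq: "(R - 1)\<^sup>2 \<le> 4 * (norm h)\<^sup>2" by (simp add: power_mult_distrib)
  have C: "0 \<le> ?C" using L by simp
  have combine: "\<bar>a - b - p\<bar> \<le> c \<Longrightarrow> c \<le> c' \<Longrightarrow> \<bar>p - q\<bar> \<le> d \<Longrightarrow> \<bar>a - b - q\<bar> \<le> c' + d"
    for a b p q c c' d :: real by linarith
  have "\<bar>G w * (R - 1 - w \<bullet> h)\<bar> \<le> ?M * (norm h)\<^sup>2"
    unfolding abs_mult using Gw Rb(1) L by (intro mult_mono) auto
  then have "\<bar>integral {0..R} H - integral {0..1} H - G w * (w \<bullet> h)\<bar> \<le> ?C * (4 * (norm h)\<^sup>2) + ?M * (norm h)\<^sup>2"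
    using combine[OF main[unfolded H1] mult_left_mono[OF sq C], of "G w * (w \<bullet> h)"]
    by (simp only: right_diff_distrib)
  then have "v * real n * \<bar>integral {0..R} H - integral {0..1} H - G w * (w \<bullet> h)\<bar> \<le> v * real n * (?C * (4 * (norm h)\<^sup>2) + ?M * (norm h)\<^sup>2)"
    using v by (intro mult_left_mono) auto
  also have "\<dots> = v * real n * (4 * ?C + ?M) * (norm h)\<^sup>2"
    by (simp only: distrib_left distrib_right mult.assoc mult.left_commute[of 4])
  also have "v * real n * \<bar>integral {0..R} H - integral {0..1} H - G w * (w \<bullet> h)\<bar>
      = \<bar>v * real n * (integral {0..R} H - integral {0..1} H - G w * (w \<bullet> h))\<bar>"
    using v by (simp add: abs_mult)
  also have "v * real n * (integral {0..R} H - integral {0..1} H - G w * (w \<bullet> h)) = J h - J 0 - v * real n * (G w * (w \<bullet> h))"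
    using Jeq[OF h] Jeq[of 0] by (simp add: R0 R_def right_diff_distrib)
  finally show ?thesis .
qed

text \<open>The error of \<open>radial_integral_estimate\<close> is uniform in the direction, so it
  survives integration over the sphere; dividing by the ball volume turns integrals into
  averages.\<close>

lemma ball_integral_expansion:
  fixes G :: "real ^ 'n::finite \<Rightarrow> real"
  assumes lip: "\<And>x y. \<bar>G x - G y\<bar> \<le> L * norm (x - y)"
  obtains C where "\<And>h. norm h \<le> 1 / 2 \<Longrightarrow>
    \<bar>(\<integral>x. G (h + x) \<partial>uniform_ball) - (\<integral>x. G x \<partial>uniform_ball)
       - (real CARD('n) *\<^sub>R (\<integral>w. G w *\<^sub>R w \<partial>uniform_sphere)) \<bullet> h\<bar> \<le> C * (norm h)\<^sup>2"
proof -
  interpret S: prob_space "uniform_sphere :: (real ^ 'n) measure"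
    by (rule prob_space_uniform_sphere)
  define v where "v = measure lborel (cball (0 :: real ^ 'n) 1)"
  have v: "v > 0" unfolding v_def by (rule ball_measure_pos)
  define n where "n = CARD('n)"
  \<comment> \<open>Any unit vector compared with 0 shows that a Lipschitz constant is
    nonnegative.\<close>
  have L: "L \<ge> 0" using order_trans[OF abs_ge_zero lip[of "axis undefined 1" 0]] by simp
  have contG: "continuous_on UNIV G"
    by (rule lipschitz_on_continuous_on[of L]) (use L lip in \<open>auto simp: lipschitz_on_def dist_norm\<close>)
  then have [measurable]: "G \<in> borel_measurable borel" by (rule borel_measurable_continuous_onI)
  define J where "J h w = (\<integral>r. radial_density TYPE('n) r * (indicator (cball h 1) (r *\<^sub>R w) * G (r *\<^sub>R w)) \<partial>lborel)" for h w
  have int: "integrable lborel (\<lambda>x. indicator (cball h 1) x * G x)" for h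
    by (rule integrable_indicator_compact[OF contG compact_cball])
  have J1: "integrable uniform_sphere (J h)" for h
    unfolding J_def by (rule integral_polar(1)[OF int])
  have J2: "(\<integral>x. G (h + x) \<partial>uniform_ball) = (\<integral>w. J h w \<partial>uniform_sphere) / v" for h
  proof -
    have "(\<integral>x. G (h + x) \<partial>uniform_ball) = (\<integral>x. indicator (cball 0 1) x * G (h + x) \<partial>lborel) / v"
      unfolding v_def by (rule integral_uniform_ball) measurable
    \<comment> \<open>Translating the argument of \<open>G\<close> is traded for translating the
      ball, so that no differentiability of \<open>G\<close> is involved.\<close>
    also have "(\<integral>x. indicator (cball 0 1) x * G (h + x) \<partial>lborel) = (\<integral>x. indicator (cball h 1) (h + x) * G (h + x) \<partial>lborel)"
      by (intro Bochner_Integration.integral_cong) (auto simp: indicator_def dist_norm)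
    also have "\<dots> = (\<integral>x. indicator (cball h 1) x * G x \<partial>distr lborel borel ((+) h))"
      by (subst integral_distr) (auto intro!: borel_measurable_times borel_measurable_indicator)
    also have "\<dots> = (\<integral>x. indicator (cball h 1) x * G x \<partial>lborel)"
      by (simp add: lborel_distr_plus)
    also have "\<dots> = (\<integral>w. J h w \<partial>uniform_sphere)"
      unfolding J_def by (rule integral_polar(2)[OF int])
    finally show ?thesis .
  qed
  have intw: "integrable uniform_sphere (\<lambda>w. G w *\<^sub>R w)"
    by (rule uniform_sphere_integrable) (intro continuous_intros contG)
  define C where "C = v * real n * (4 * (2 ^ (n - 1) * L + (\<bar>G 0\<bar> + L) * 3 ^ (n - 1)) + (\<bar>G 0\<bar> + L))"
  show ?thesis
  proof (rule that[of "C / v"])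
    fix h :: "real ^ 'n" assume h: "norm h \<le> 1 / 2"
    have inner: "(\<integral>w. G w *\<^sub>R w \<partial>uniform_sphere) \<bullet> h = (\<integral>w. G w * (w \<bullet> h) \<partial>uniform_sphere)"
      using intw by (simp flip: integral_inner_left)
    have intwh: "integrable uniform_sphere (\<lambda>w. G w * (w \<bullet> h))"
      using integrable_inner_left[of h uniform_sphere "\<lambda>w. G w *\<^sub>R w"] intw by simp
    let ?d = "\<lambda>w. J h w - J 0 w - v * real n * (G w * (w \<bullet> h))"
    have "\<bar>\<integral>w. ?d w \<partial>uniform_sphere\<bar> \<le> (\<integral>w. \<bar>?d w\<bar> \<partial>uniform_sphere)"
      by (rule integral_abs_bound)
    also have "\<dots> \<le> (\<integral>w. C * (norm h)\<^sup>2 \<partial>(uniform_sphere :: (real ^ 'n) measure))"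
    proof (rule integral_mono_AE)
      show "AE w in uniform_sphere. \<bar>?d w\<bar> \<le> C * (norm h)\<^sup>2"
        using AE_uniform_sphere
        by eventually_elim (unfold J_def C_def v_def n_def, rule radial_integral_estimate[OF lip _ h])
    qed (use J1 intwh in auto)
    also have "\<dots> = C * (norm h)\<^sup>2" using S.prob_space by simp
    also have "(\<integral>w. ?d w \<partial>uniform_sphere) = (\<integral>w. J h w \<partial>uniform_sphere) - (\<integral>w. J 0 w \<partial>uniform_sphere) - v * real n * (\<integral>w. G w * (w \<bullet> h) \<partial>uniform_sphere)"
      using J1 intwh by simp
    finally have "\<bar>(\<integral>w. J h w \<partial>uniform_sphere) - (\<integral>w. J 0 w \<partial>uniform_sphere) - v * real n * (\<integral>w. G w * (w \<bullet> h) \<partial>uniform_sphere)\<bar> / v \<le> C * (norm h)\<^sup>2 / v"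
      using v by (intro divide_right_mono) auto
    moreover have "\<bar>(\<integral>w. J h w \<partial>uniform_sphere) - (\<integral>w. J 0 w \<partial>uniform_sphere) - v * real n * (\<integral>w. G w * (w \<bullet> h) \<partial>uniform_sphere)\<bar> / v
      = \<bar>(\<integral>w. J h w \<partial>uniform_sphere) / v - (\<integral>w. J 0 w \<partial>uniform_sphere) / v - real n * (\<integral>w. G w * (w \<bullet> h) \<partial>uniform_sphere)\<bar>"
      using v by (simp add: abs_divide[symmetric, of _ v, unfolded abs_of_pos[OF v]] diff_divide_distrib)
    ultimately show "\<bar>(\<integral>x. G (h + x) \<partial>uniform_ball) - (\<integral>x. G x \<partial>uniform_ball)
       - (real CARD('n) *\<^sub>R (\<integral>w. G w *\<^sub>R w \<partial>uniform_sphere)) \<bullet> h\<bar> \<le> C / v * (norm h)\<^sup>2"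
      using J2[of h] J2[of 0] by (simp add: inner n_def)
  qed
qed

lemma GDERIV_of_quadratic_bound:
  fixes f :: "'a::real_inner \<Rightarrow> real"
  assumes "\<epsilon> > 0" and bd: "\<And>y. norm (y - x) \<le> \<epsilon> \<Longrightarrow> \<bar>f y - f x - D \<bullet> (y - x)\<bar> \<le> C * (norm (y - x))\<^sup>2"
  shows "GDERIV f x :> D"
  unfolding gderiv_def
proof (rule has_derivativeI_sandwich[where e=\<epsilon> and H="\<lambda>y. C * norm (y - x)"])
  show "bounded_linear (\<lambda>h. h \<bullet> D)" by (rule bounded_linear_inner_left)
  show "((\<lambda>y. C * norm (y - x)) \<longlongrightarrow> 0) (at x)"
    by (auto intro!: tendsto_eq_intros)
  fix y assume y: "y \<noteq> x" "dist y x < \<epsilon>"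
  then have "\<bar>f y - f x - D \<bullet> (y - x)\<bar> \<le> C * (norm (y - x))\<^sup>2"
    by (intro bd) (simp add: dist_norm)
  then show "norm (f y - f x - (y - x) \<bullet> D) / norm (y - x) \<le> C * norm (y - x)"
    using y by (simp add: inner_commute divide_simps power2_eq_square mult.assoc)
qed (fact \<open>\<epsilon> > 0\<close>)

text \<open>The expansion is applied to v \<mapsto> F(x + \<xi> v), whose Lipschitz constant is L
  \<xi>, with y - x = \<xi> h. Expressed in y, this turns n into n / \<xi>, the radius 1/2 into
  \<xi> / 2 and C into C / \<xi>^2.\<close>

lemma GDERIV_ball_average:
  fixes F :: "real ^ 'n::finite \<Rightarrow> real"
  assumes lip: "\<And>x y. \<bar>F x - F y\<bar> \<le> L * norm (x - y)" and xi: "\<xi> > 0"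
  shows "GDERIV (\<lambda>x. \<integral>v. F (x + \<xi> *\<^sub>R v) \<partial>uniform_ball) x
    :> (real CARD('n) / \<xi>) *\<^sub>R (\<integral>w. F (x + \<xi> *\<^sub>R w) *\<^sub>R w \<partial>uniform_sphere)"
proof -
  have "\<bar>F (x + \<xi> *\<^sub>R a) - F (x + \<xi> *\<^sub>R b)\<bar> \<le> (L * \<xi>) * norm (a - b)" for a b
    using lip[of "x + \<xi> *\<^sub>R a" "x + \<xi> *\<^sub>R b"] xi by (simp add: scaleR_diff_right[symmetric] mult.assoc)
  then obtain C where C: "\<And>h. norm h \<le> 1 / 2 \<Longrightarrow>
    \<bar>(\<integral>v. F (x + \<xi> *\<^sub>R (h + v)) \<partial>uniform_ball) - (\<integral>v. F (x + \<xi> *\<^sub>R v) \<partial>uniform_ball)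
       - (real CARD('n) *\<^sub>R (\<integral>w. F (x + \<xi> *\<^sub>R w) *\<^sub>R w \<partial>uniform_sphere)) \<bullet> h\<bar> \<le> C * (norm h)\<^sup>2"
    by (rule ball_integral_expansion) (rule that)
  show ?thesis
  proof (rule GDERIV_of_quadratic_bound[where \<epsilon>="\<xi> / 2" and C="C / \<xi>\<^sup>2"])
    fix y :: "real ^ 'n" assume y: "norm (y - x) \<le> \<xi> / 2"
    define h where "h = (1 / \<xi>) *\<^sub>R (y - x)"
    have y': "y - x = \<xi> *\<^sub>R h" "x + \<xi> *\<^sub>R (h + v) = y + \<xi> *\<^sub>R v" for v
      using xi by (auto simp: h_def algebra_simps)
    have nh: "norm h = norm (y - x) / \<xi>" using xi by (simp add: h_def)
    have "norm h \<le> 1 / 2" using y xi by (simp add: nh field_simps)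
    from C[OF this] show "\<bar>(\<integral>v. F (y + \<xi> *\<^sub>R v) \<partial>uniform_ball) - (\<integral>v. F (x + \<xi> *\<^sub>R v) \<partial>uniform_ball)
      - ((real CARD('n) / \<xi>) *\<^sub>R (\<integral>w. F (x + \<xi> *\<^sub>R w) *\<^sub>R w \<partial>uniform_sphere)) \<bullet> (y - x)\<bar> \<le> C / \<xi>\<^sup>2 * (norm (y - x))\<^sup>2"
      using xi unfolding y'(2) nh by (simp add: h_def power_divide)
  qed (use xi in auto)
qed

lemma integral_uniform_sphere_id: "(\<integral>w. w \<partial>(uniform_sphere :: (real ^ 'n::finite) measure)) = 0"
proof -
  have "GDERIV (\<lambda>x::real ^ 'n. \<integral>v. 1 \<partial>(uniform_ball :: (real ^ 'n) measure)) 0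
    :> (real CARD('n) / 1) *\<^sub>R (\<integral>w. 1 *\<^sub>R w \<partial>(uniform_sphere :: (real ^ 'n) measure))"
    by (rule GDERIV_ball_average[where L=0]) auto
  from has_derivative_unique[OF this[unfolded gderiv_def] has_derivative_const]
  have "\<And>h. h \<bullet> (real CARD('n) *\<^sub>R (\<integral>w. w \<partial>(uniform_sphere :: (real ^ 'n) measure))) = 0"
    by (auto dest: fun_cong)
  \<comment> \<open>Taking the mean itself for \<open>h\<close> makes n times its squared norm
    zero.\<close>
  from this[of "\<integral>w. w \<partial>(uniform_sphere :: (real ^ 'n) measure)"] show ?thesis by simp
qed

section \<open>The descent inequality\<close>

lemma gradient_eq_of_GDERIV:
  fixes h :: "'a::euclidean_space \<Rightarrow> real"
  assumes "GDERIV h x :> D"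
  shows "gradient h x = D"
  unfolding gradient_def
proof (rule the_equality)
  show "GDERIV h x :> D" by (rule assms)
  fix D' assume "GDERIV h x :> D'"
  then have "(\<lambda>h. h \<bullet> D') = (\<lambda>h. h \<bullet> D)"
    using assms unfolding gderiv_def by (rule has_derivative_unique)
  then show "D' = D" by (metis inner_commute vector_eq_rdot)
qed

lemma infdist_eq_norm_closest_point:
  "closed S \<Longrightarrow> S \<noteq> {} \<Longrightarrow> infdist x S = norm (x - closest_point S x)"
  by (simp add: infdist_eq_setdist setdist_closest_point dist_norm)

lemma norm_add_sq:
  fixes a b :: "'a::real_inner"
  shows "(norm (a + b))\<^sup>2 = (norm a)\<^sup>2 + 2 * (a \<bullet> b) + (norm b)\<^sup>2"
  unfolding power2_norm_eq_inner by (simp add: inner_add inner_commute)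

text \<open>The projection of x is a competitor for the distance from y; expanding the square around
  x gives the three terms.\<close>

lemma infdist_sq_le:
  fixes S :: "'a::euclidean_space set"
  assumes "closed S" "S \<noteq> {}"
  shows "(infdist y S)\<^sup>2 \<le> (infdist x S)\<^sup>2 + 2 * ((x - closest_point S x) \<bullet> (y - x)) + (norm (y - x))\<^sup>2"
proof -
  have "infdist y S \<le> norm (y - closest_point S x)"
    using infdist_le[OF closest_point_in_set[OF assms]] by (simp add: dist_norm)
  then have "(infdist y S)\<^sup>2 \<le> (norm ((x - closest_point S x) + (y - x)))\<^sup>2"
    by (intro power_mono) (auto simp: infdist_nonneg)
  also have "\<dots> = (norm (x - closest_point S x))\<^sup>2 + 2 * ((x - closest_point S x) \<bullet> (y - x)) + (norm (y - x))\<^sup>2"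
    by (rule norm_add_sq)
  finally show ?thesis by (simp add: infdist_eq_norm_closest_point assms)
qed

text \<open>The upper bound is applied with x and y exchanged, which puts the residual at y in the
  inner product. Nonexpansiveness of the projection makes the residual map monotone, so the residual
  at x may replace it.\<close>

lemma infdist_sq_ge:
  fixes S :: "'a::euclidean_space set"
  assumes "closed S" "S \<noteq> {}" "convex S"
  shows "(infdist y S)\<^sup>2 \<ge> (infdist x S)\<^sup>2 + 2 * ((x - closest_point S x) \<bullet> (y - x)) - (norm (y - x))\<^sup>2"
proof -
  have "(closest_point S y - closest_point S x) \<bullet> (y - x) \<le> norm (closest_point S y - closest_point S x) * norm (y - x)"
    by (rule norm_cauchy_schwarz)
  also have "\<dots> \<le> norm (y - x) * norm (y - x)"
    using closest_point_lipschitz[OF assms(3,1,2), of y x]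
    by (intro mult_right_mono) (auto simp: dist_norm)
  finally have "(closest_point S y - closest_point S x) \<bullet> (y - x) \<le> (y - x) \<bullet> (y - x)"
    by (simp add: power2_eq_square[symmetric] power2_norm_eq_inner)
  then have "(x - closest_point S x) \<bullet> (y - x) \<le> (y - closest_point S y) \<bullet> (y - x)"
    by (simp add: inner_diff_left)
  moreover have "(y - closest_point S y) \<bullet> (x - y) = - ((y - closest_point S y) \<bullet> (y - x))"
    by (simp add: inner_diff_right)
  ultimately show ?thesis
    using infdist_sq_le[OF assms(1,2), of x y] norm_minus_commute[of x y] by simp
qed

text \<open>\<open>S\<close> stands for the sum of the equilibrium costs and \<open>L\<close> for
  its Lipschitz constant, which is N times the constant of a single player. The stepsize bound is
  that of the theorem in these terms.\<close>

locale zeroth_order =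
  fixes S :: "real ^ 'n::finite \<Rightarrow> real" and \<Theta> :: "(real ^ 'n) set" and L \<xi> \<alpha> :: real
  assumes lip: "\<bar>S x - S y\<bar> \<le> L * norm (x - y)"
    and xi: "\<xi> > 0" and alpha: "\<alpha> > 0" "\<alpha> \<le> \<xi> / (2 * (real CARD('n) * L + 1))"
    and \<Theta>: "closed \<Theta>" "\<Theta> \<noteq> {}" "convex \<Theta>"
begin

abbreviation "proj \<equiv> closest_point \<Theta>"

definition "obj x = (\<integral>v. S (x + \<xi> *\<^sub>R v) \<partial>uniform_ball) + 1 / (2 * \<xi>) * (infdist x \<Theta>)\<^sup>2"

definition "smooth_grad x = (real CARD('n) / \<xi>) *\<^sub>R (\<integral>w. S (x + \<xi> *\<^sub>R w) *\<^sub>R w \<partial>uniform_sphere)"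

definition "pen_grad x = (1 / \<xi>) *\<^sub>R (x - proj x)"

definition "obj_grad x = smooth_grad x + pen_grad x"

definition "estimate x u = (real CARD('n) / \<xi> * (S (x + \<xi> *\<^sub>R u) - S x)) *\<^sub>R u"

definition "step x u = x - \<alpha> *\<^sub>R (estimate x u + pen_grad x)"

definition "smoothness = (real CARD('n) * L + 1) / \<xi>"

section \<open>Gradient, continuity and Lipschitz constants of the penalized objective\<close>

lemma L_nonneg: "0 \<le> L"
  using order_trans[OF abs_ge_zero lip[of "axis undefined 1" 0]] by simp

lemma smoothness_pos: "0 < smoothness"
  using L_nonneg xi by (simp add: smoothness_def add_nonneg_pos)

lemma alpha_smoothness: "\<alpha> * smoothness \<le> 1 / 2"
proof -
  have p: "0 < 2 * (real CARD('n) * L + 1)" using L_nonneg by (simp add: add_nonneg_pos)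
  have "\<alpha> * (2 * (real CARD('n) * L + 1)) \<le> \<xi>"
    using alpha(2) p by (simp add: pos_le_divide_eq)
  then show ?thesis using xi by (simp add: smoothness_def field_simps)
qed

lemma continuous_S: "continuous_on UNIV S"
  by (rule lipschitz_on_continuous_on[of L])
    (use L_nonneg lip in \<open>auto simp: lipschitz_on_def dist_norm\<close>)

lemma integrable_S_sphere: "integrable uniform_sphere (\<lambda>w. S (x + \<xi> *\<^sub>R w) *\<^sub>R w)"
  by (intro uniform_sphere_integrable continuous_intros continuous_on_compose2[OF continuous_S]) auto

lemma GDERIV_smooth: "GDERIV (\<lambda>x. \<integral>v. S (x + \<xi> *\<^sub>R v) \<partial>uniform_ball) x :> smooth_grad x"
  unfolding smooth_grad_def by (rule GDERIV_ball_average[OF lip xi])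

text \<open>The upper and lower quadratic bounds on the squared distance have the same linear term,
  so this term is the derivative.\<close>

lemma GDERIV_pen: "GDERIV (\<lambda>x. 1 / (2 * \<xi>) * (infdist x \<Theta>)\<^sup>2) x :> pen_grad x"
proof (rule GDERIV_of_quadratic_bound[where \<epsilon>=1 and C="1 / (2 * \<xi>)"])
  fix y
  have "\<bar>(infdist y \<Theta>)\<^sup>2 - (infdist x \<Theta>)\<^sup>2 - 2 * ((x - proj x) \<bullet> (y - x))\<bar> \<le> (norm (y - x))\<^sup>2"
    using infdist_sq_le[OF \<Theta>(1,2), of y x] infdist_sq_ge[OF \<Theta>, of x y] by linarith
  then have "1 / (2 * \<xi>) * \<bar>(infdist y \<Theta>)\<^sup>2 - (infdist x \<Theta>)\<^sup>2 - 2 * ((x - proj x) \<bullet> (y - x))\<bar> \<le> 1 / (2 * \<xi>) * (norm (y - x))\<^sup>2"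
    using xi by (intro mult_left_mono) auto
  moreover have "1 / (2 * \<xi>) * (infdist y \<Theta>)\<^sup>2 - 1 / (2 * \<xi>) * (infdist x \<Theta>)\<^sup>2 - pen_grad x \<bullet> (y - x)
     = 1 / (2 * \<xi>) * ((infdist y \<Theta>)\<^sup>2 - (infdist x \<Theta>)\<^sup>2 - 2 * ((x - proj x) \<bullet> (y - x)))"
    using xi by (simp add: pen_grad_def right_diff_distrib del: scaleR_diff_right)
  ultimately show "\<bar>1 / (2 * \<xi>) * (infdist y \<Theta>)\<^sup>2 - 1 / (2 * \<xi>) * (infdist x \<Theta>)\<^sup>2 - pen_grad x \<bullet> (y - x)\<bar> \<le> 1 / (2 * \<xi>) * (norm (y - x))\<^sup>2"
    using xi by (simp only: abs_mult) simp
qed simp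

lemma GDERIV_obj: "GDERIV obj x :> obj_grad x"
  unfolding obj_def[abs_def] obj_grad_def by (rule GDERIV_add[OF GDERIV_smooth GDERIV_pen])

lemma gradient_obj: "gradient obj x = obj_grad x"
  by (rule gradient_eq_of_GDERIV[OF GDERIV_obj])

lemma continuous_obj: "continuous_on UNIV obj"
  by (rule has_derivative_continuous_on) (rule GDERIV_obj[unfolded gderiv_def])

text \<open>Both means use the same unit vectors w, so the integrands differ in norm by |S(x + \<xi>
  w) - S(y + \<xi> w)| \<le> L |x - y|.\<close>

lemma smooth_grad_lipschitz: "norm (smooth_grad x - smooth_grad y) \<le> real CARD('n) * L / \<xi> * norm (x - y)"
proof -
  interpret P: prob_space "uniform_sphere :: (real ^ 'n) measure"
    by (rule prob_space_uniform_sphere)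
  have "norm (\<integral>w. S (x + \<xi> *\<^sub>R w) *\<^sub>R w - S (y + \<xi> *\<^sub>R w) *\<^sub>R w \<partial>uniform_sphere)
    \<le> (\<integral>w. norm (S (x + \<xi> *\<^sub>R w) *\<^sub>R w - S (y + \<xi> *\<^sub>R w) *\<^sub>R w) \<partial>uniform_sphere)"
    by (rule integral_norm_bound)
  also have "\<dots> \<le> (\<integral>w. L * norm (x - y) \<partial>(uniform_sphere :: (real ^ 'n) measure))"
  proof (rule integral_mono_AE)
    show "AE w in uniform_sphere. norm (S (x + \<xi> *\<^sub>R w) *\<^sub>R w - S (y + \<xi> *\<^sub>R w) *\<^sub>R w) \<le> L * norm (x - y)"
      using AE_uniform_sphere
    proof eventually_elim
      case (elim w)
      then show ?case using lip[of "x + \<xi> *\<^sub>R w" "y + \<xi> *\<^sub>R w"]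
        by (simp flip: scaleR_diff_left)
    qed
  qed (use integrable_S_sphere in auto)
  also have "\<dots> = L * norm (x - y)" using P.prob_space by simp
  finally have *: "norm ((\<integral>w. S (x + \<xi> *\<^sub>R w) *\<^sub>R w \<partial>uniform_sphere) - (\<integral>w. S (y + \<xi> *\<^sub>R w) *\<^sub>R w \<partial>uniform_sphere)) \<le> L * norm (x - y)"
    using integrable_S_sphere by simp
  show ?thesis
    using mult_left_mono[OF *, of "real CARD('n) / \<xi>"] xi
    by (simp add: smooth_grad_def flip: scaleR_diff_right)
qed

lemma continuous_smooth_grad: "continuous_on UNIV smooth_grad"
  by (rule lipschitz_on_continuous_on[of "real CARD('n) * L / \<xi>"])
    (use L_nonneg xi smooth_grad_lipschitz in \<open>auto simp: lipschitz_on_def dist_norm\<close>)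

lemma continuous_proj: "continuous_on UNIV proj"
  by (rule continuous_on_closest_point) (use \<Theta> in auto)

lemma continuous_pen_grad: "continuous_on UNIV pen_grad"
  unfolding pen_grad_def by (intro continuous_intros continuous_proj)

lemma continuous_obj_grad: "continuous_on UNIV obj_grad"
  unfolding obj_grad_def by (intro continuous_intros continuous_smooth_grad continuous_pen_grad)

lemma continuous_step: "continuous_on UNIV (\<lambda>p. step (fst p) (snd p))"
  unfolding step_def estimate_def
  by (intro continuous_intros continuous_on_compose2[OF continuous_S] continuous_on_compose2[OF continuous_pen_grad]) auto

section \<open>Descent in one step of the algorithm\<close>

text \<open>The mean value theorem loses the factor \<open>1/2\<close> in the quadratic term, which the constants
  of the final bound can absorb.\<close>

lemma smooth_descent:
  "(\<integral>v. S (y + \<xi> *\<^sub>R v) \<partial>uniform_ball) \<le> (\<integral>v. S (x + \<xi> *\<^sub>R v) \<partial>uniform_ball)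
     + smooth_grad x \<bullet> (y - x) + real CARD('n) * L / \<xi> * (norm (y - x))\<^sup>2"
proof -
  let ?A = "\<lambda>x. \<integral>v. S (x + \<xi> *\<^sub>R v) \<partial>uniform_ball" and ?c = "real CARD('n) * L / \<xi>"
  have c: "?c \<ge> 0" using L_nonneg xi by simp
  have "norm ((?A y - smooth_grad x \<bullet> y) - (?A x - smooth_grad x \<bullet> x)) \<le> (?c * norm (y - x)) * norm (y - x)"
  proof (rule differentiable_bound[where S="closed_segment x y" and f'="\<lambda>z h. (smooth_grad z - smooth_grad x) \<bullet> h"])
    fix z assume z: "z \<in> closed_segment x y"
    have "(?A has_derivative (\<lambda>h. h \<bullet> smooth_grad z)) (at z within closed_segment x y)"
      using GDERIV_smooth[of z] unfolding gderiv_def by (rule has_derivative_at_withinI)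
    then show "((\<lambda>y. ?A y - smooth_grad x \<bullet> y) has_derivative (\<lambda>h. (smooth_grad z - smooth_grad x) \<bullet> h)) (at z within closed_segment x y)"
      by (auto intro!: derivative_eq_intros simp: inner_diff_left inner_diff_right inner_commute)
    have "norm ((smooth_grad z - smooth_grad x) \<bullet> h) \<le> (?c * norm (y - x)) * norm h" for h
    proof -
      have "norm ((smooth_grad z - smooth_grad x) \<bullet> h) \<le> norm (smooth_grad z - smooth_grad x) * norm h"
        using Cauchy_Schwarz_ineq2 by simp
      also have "\<dots> \<le> (?c * norm (z - x)) * norm h"
        by (intro mult_right_mono smooth_grad_lipschitz) simp
      also have "\<dots> \<le> (?c * norm (y - x)) * norm h"
        using c segment_bound(1)[OF z] by (intro mult_right_mono mult_left_mono) auto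
      finally show ?thesis .
    qed
    then show "onorm ((\<bullet>) (smooth_grad z - smooth_grad x)) \<le> ?c * norm (y - x)"
      by (rule onorm_le)
  qed auto
  then show ?thesis by (simp add: inner_diff_right power2_eq_square)
qed

lemma obj_descent: "obj y \<le> obj x + obj_grad x \<bullet> (y - x) + smoothness * (norm (y - x))\<^sup>2"
proof -
  have "1 / (2 * \<xi>) * (infdist y \<Theta>)\<^sup>2 \<le> 1 / (2 * \<xi>) * ((infdist x \<Theta>)\<^sup>2 + 2 * ((x - proj x) \<bullet> (y - x)) + (norm (y - x))\<^sup>2)"
    using xi by (intro mult_left_mono infdist_sq_le \<Theta>) auto
  also have "\<dots> = 1 / (2 * \<xi>) * (infdist x \<Theta>)\<^sup>2 + pen_grad x \<bullet> (y - x) + 1 / (2 * \<xi>) * (norm (y - x))\<^sup>2"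
    using xi by (simp add: pen_grad_def distrib_left del: scaleR_diff_right)
  \<comment> \<open>The quadratic coefficient is doubled so that it adds up with that of
    \<open>smooth_descent\<close> to \<open>smoothness\<close>.\<close>
  also have "\<dots> \<le> 1 / (2 * \<xi>) * (infdist x \<Theta>)\<^sup>2 + pen_grad x \<bullet> (y - x) + 1 / \<xi> * (norm (y - x))\<^sup>2"
    using xi by (intro add_mono mult_right_mono) (auto simp: field_simps)
  finally show ?thesis using smooth_descent[of y x]
    by (simp add: obj_def obj_grad_def smoothness_def inner_add_left add_divide_distrib distrib_right)
qed

text \<open>The increment of \<open>S\<close> over a distance \<xi> is at most L \<xi>, which
  cancels the division by \<xi>; the noise bound is therefore independent of the smoothing
  parameter.\<close>

lemma norm_estimate_le:
  assumes "norm u = 1"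
  shows "norm (estimate x u) \<le> real CARD('n) * L"
proof -
  have "\<bar>S (x + \<xi> *\<^sub>R u) - S x\<bar> \<le> L * \<xi>"
    using lip[of "x + \<xi> *\<^sub>R u" x] assms xi by simp
  then have "real CARD('n) / \<xi> * \<bar>S (x + \<xi> *\<^sub>R u) - S x\<bar> \<le> real CARD('n) / \<xi> * (L * \<xi>)"
    using xi by (intro mult_left_mono) auto
  then show ?thesis using assms xi by (simp add: estimate_def abs_mult)
qed

lemma integrable_estimate: "integrable uniform_sphere (estimate x)"
  unfolding estimate_def
  by (intro uniform_sphere_integrable continuous_intros continuous_on_compose2[OF continuous_S]) auto

text \<open>The baseline value \<open>S x\<close> multiplies the mean of the sphere, which is
  zero.\<close>

lemma integral_estimate: "(\<integral>u. estimate x u \<partial>uniform_sphere) = smooth_grad x"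
proof -
  have int: "integrable uniform_sphere (\<lambda>u :: real ^ 'n. u)"
    by (intro uniform_sphere_integrable continuous_intros)
  have "(\<integral>u. estimate x u \<partial>uniform_sphere)
    = (\<integral>u. (real CARD('n) / \<xi>) *\<^sub>R (S (x + \<xi> *\<^sub>R u) *\<^sub>R u) - (real CARD('n) / \<xi> * S x) *\<^sub>R u \<partial>uniform_sphere)"
    by (simp add: estimate_def algebra_simps diff_divide_distrib)
  also have "\<dots> = (\<integral>u. (real CARD('n) / \<xi>) *\<^sub>R (S (x + \<xi> *\<^sub>R u) *\<^sub>R u) \<partial>uniform_sphere) - (\<integral>u. (real CARD('n) / \<xi> * S x) *\<^sub>R u \<partial>uniform_sphere)"
    by (intro Bochner_Integration.integral_diff integrable_scaleR_right int integrable_S_sphere)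
  also have "\<dots> = smooth_grad x"
    by (simp add: integral_uniform_sphere_id smooth_grad_def del: scaleR_scaleR)
  finally show ?thesis .
qed

text \<open>Only the estimator is bounded, while the penalty gradient may be arbitrarily large.
  Hence the bound C^2 replaces the squared estimator alone; the penalty terms are kept and
  recombined into the full gradient after averaging, where the stepsize condition absorbs
  them.\<close>

lemma expected_descent:
  "(\<integral>u. obj (step x u) \<partial>uniform_sphere)
    \<le> obj x - \<alpha> / 2 * (norm (obj_grad x))\<^sup>2 + smoothness * \<alpha>\<^sup>2 * (real CARD('n) * L)\<^sup>2"
proof -
  interpret P: prob_space "uniform_sphere :: (real ^ 'n) measure"
    by (rule prob_space_uniform_sphere)
  let ?C = "real CARD('n) * L"
  \<comment> \<open>This majorant is affine in \<open>e\<close>, so averaging it amounts to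
    inserting the mean of the estimator.\<close>
  let ?b = "\<lambda>e. obj x - \<alpha> * (obj_grad x \<bullet> (e + pen_grad x))
       + smoothness * \<alpha>\<^sup>2 * (?C\<^sup>2 + 2 * (pen_grad x \<bullet> e) + (norm (pen_grad x))\<^sup>2)"
  have intc: "integrable uniform_sphere (\<lambda>u. a \<bullet> estimate x u)" for a
    using integrable_inner_right[of a uniform_sphere "estimate x"] integrable_estimate by simp
  have "(\<integral>u. obj (step x u) \<partial>uniform_sphere) \<le> (\<integral>u. ?b (estimate x u) \<partial>uniform_sphere)"
  proof (rule integral_mono_AE)
    show "integrable uniform_sphere (\<lambda>u. obj (step x u))"
      by (rule uniform_sphere_integrable)
        (rule continuous_on_compose2[OF continuous_obj continuous_on_compose2[OF continuous_step, of _ "\<lambda>u. (x, u)"], simplified],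
          auto intro!: continuous_intros)
    show "integrable uniform_sphere (\<lambda>u. ?b (estimate x u))"
      by (simp add: inner_add_right intc)
    show "AE u in uniform_sphere. obj (step x u) \<le> ?b (estimate x u)"
      using AE_uniform_sphere
    proof eventually_elim
      case (elim u)
      let ?e = "estimate x u"
      have "(norm (?e + pen_grad x))\<^sup>2 = (norm ?e)\<^sup>2 + 2 * (pen_grad x \<bullet> ?e) + (norm (pen_grad x))\<^sup>2"
        by (simp add: norm_add_sq inner_commute)
      also have "\<dots> \<le> ?C\<^sup>2 + 2 * (pen_grad x \<bullet> ?e) + (norm (pen_grad x))\<^sup>2"
        using power_mono[OF norm_estimate_le[OF elim], of x 2] by simp
      finally have "smoothness * \<alpha>\<^sup>2 * (norm (?e + pen_grad x))\<^sup>2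
        \<le> smoothness * \<alpha>\<^sup>2 * (?C\<^sup>2 + 2 * (pen_grad x \<bullet> ?e) + (norm (pen_grad x))\<^sup>2)"
        using smoothness_pos by (intro mult_left_mono) auto
      moreover have "step x u - x = - (\<alpha> *\<^sub>R (?e + pen_grad x))" by (simp add: step_def)
      ultimately show ?case
        using obj_descent[of "step x u" x] alpha(1) by (simp add: power_mult_distrib mult.assoc)
    qed
  qed
  also have "\<dots> = ?b (smooth_grad x)"
    using integrable_estimate integral_inner_right[of _ uniform_sphere "estimate x"] P.prob_space intc
    by (simp add: inner_add_right integral_estimate)
  also have "\<dots> \<le> obj x - \<alpha> * (norm (obj_grad x))\<^sup>2 + smoothness * \<alpha>\<^sup>2 * (?C\<^sup>2 + (norm (obj_grad x))\<^sup>2)"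
  proof -
    \<comment> \<open>Adding the nonnegative |\<open>smooth_grad x\<close>|^2 completes the square
      of the full gradient.\<close>
    have "2 * (pen_grad x \<bullet> smooth_grad x) + (norm (pen_grad x))\<^sup>2 \<le> (norm (obj_grad x))\<^sup>2"
      unfolding power2_norm_eq_inner obj_grad_def by (simp add: inner_add inner_commute)
    then have "smoothness * \<alpha>\<^sup>2 * (?C\<^sup>2 + 2 * (pen_grad x \<bullet> smooth_grad x) + (norm (pen_grad x))\<^sup>2)
      \<le> smoothness * \<alpha>\<^sup>2 * (?C\<^sup>2 + (norm (obj_grad x))\<^sup>2)"
      using smoothness_pos by (intro mult_left_mono) auto
    then show ?thesis by (simp add: obj_grad_def[symmetric] power2_norm_eq_inner)
  qed
  also have "\<dots> \<le> obj x - \<alpha> / 2 * (norm (obj_grad x))\<^sup>2 + smoothness * \<alpha>\<^sup>2 * ?C\<^sup>2"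
  proof -
    \<comment> \<open>The condition \<alpha> \<open>smoothness\<close> \<le> 1/2 spends half of the
      decrease on the quadratic error; the other half remains.\<close>
    have "(\<alpha> * smoothness) * (\<alpha> * (norm (obj_grad x))\<^sup>2) \<le> 1 / 2 * (\<alpha> * (norm (obj_grad x))\<^sup>2)"
      using alpha(1) by (intro mult_right_mono alpha_smoothness) auto
    then show ?thesis by (simp add: power2_eq_square algebra_simps)
  qed
  finally show ?thesis .
qed

end

section \<open>Averaging over the iterations\<close>

text \<open>Independence makes the joint law a product, so Fubini integrates out \<open>Y\<close>
  with \<open>X\<close> frozen. This takes the place of conditioning on the past.\<close>

lemma (in prob_space) indep_var_expectation_iterated:
  fixes X Y :: "'a \<Rightarrow> 'b::euclidean_space" and h :: "'b \<Rightarrow> 'b \<Rightarrow> real"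
  assumes ind: "indep_var borel X borel Y"
    and [measurable]: "(\<lambda>p. h (fst p) (snd p)) \<in> borel_measurable borel"
    and int: "integrable M (\<lambda>\<omega>. h (X \<omega>) (Y \<omega>))"
  shows "expectation (\<lambda>\<omega>. h (X \<omega>) (Y \<omega>)) = expectation (\<lambda>\<omega>. \<integral>y. h (X \<omega>) y \<partial>distr M borel Y)" (is ?A)
    and "integrable M (\<lambda>\<omega>. \<integral>y. h (X \<omega>) y \<partial>distr M borel Y)" (is ?B)
proof -
  have [measurable]: "X \<in> borel_measurable M" "Y \<in> borel_measurable M"
    and eq: "distr M borel X \<Otimes>\<^sub>M distr M borel Y = distr M (borel \<Otimes>\<^sub>M borel) (\<lambda>\<omega>. (X \<omega>, Y \<omega>))"
    using ind unfolding indep_var_distribution_eq by auto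
  interpret X: prob_space "distr M borel X" by (rule prob_space_distr) simp
  interpret Y: prob_space "distr M borel Y" by (rule prob_space_distr) simp
  interpret P: pair_prob_space "distr M borel X" "distr M borel Y" ..
  have hm: "(\<lambda>(x, y). h x y) \<in> borel_measurable (borel \<Otimes>\<^sub>M borel)"
    using assms(2) by (simp add: borel_prod case_prod_beta')
  have int': "integrable (distr M borel X \<Otimes>\<^sub>M distr M borel Y) (\<lambda>(x, y). h x y)"
    unfolding eq by (subst integrable_distr_eq) (use int hm in auto)
  have hm': "(\<lambda>x. \<integral>y. h x y \<partial>distr M borel Y) \<in> borel_measurable borel"
    using borel_measurable_integrable[OF P.integrable_fst'[OF int']] by simp
  have "expectation (\<lambda>\<omega>. h (X \<omega>) (Y \<omega>)) = (\<integral>p. (\<lambda>(x, y). h x y) p \<partial>distr M (borel \<Otimes>\<^sub>M borel) (\<lambda>\<omega>. (X \<omega>, Y \<omega>)))"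
    by (subst integral_distr) (use hm in auto)
  also have "\<dots> = (\<integral>x. \<integral>y. h x y \<partial>distr M borel Y \<partial>distr M borel X)"
    unfolding eq[symmetric] using P.integral_fst'[OF int'] by simp
  also have "\<dots> = expectation (\<lambda>\<omega>. \<integral>y. h (X \<omega>) y \<partial>distr M borel Y)"
    by (rule integral_distr) (use hm' in auto)
  finally show ?A .
  show ?B
    using P.integrable_fst'[OF int'] by (subst (asm) integrable_distr_eq) (use hm' in auto)
qed

section \<open>The iterates as functions of the directions drawn\<close>

context zeroth_order
begin

primrec iterate :: "real ^ 'n \<Rightarrow> (nat \<Rightarrow> real ^ 'n) \<Rightarrow> nat \<Rightarrow> real ^ 'n" where
  "iterate x u 0 = x"
| "iterate x u (Suc k) = step (iterate x u k) (u k)"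

text \<open>Makes the iterate a function of the past directions alone, which \<open>indep_it\<close>
  exploits.\<close>

lemma iterate_cong: "(\<And>j. j < k \<Longrightarrow> u j = u' j) \<Longrightarrow> iterate x u k = iterate x u' k"
  by (induction k) auto

lemma step_measurable [measurable]:
  assumes [measurable]: "f \<in> borel_measurable N" "g \<in> borel_measurable N"
  shows "(\<lambda>y. step (f y) (g y)) \<in> borel_measurable N"
  using borel_measurable_continuous_Pair[OF assms continuous_step] .

lemma iterate_measurable:
  assumes "\<And>j. j < k \<Longrightarrow> (\<lambda>\<omega>. u \<omega> j) \<in> borel_measurable N"
  shows "(\<lambda>\<omega>. iterate x (u \<omega>) k) \<in> borel_measurable N"
  using assms by (induction k) auto

text \<open>A fixed point \<open>t\<close> of the feasible set bounds the projection residual by |x|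
  + |t|, so a step enlarges the norm at most affinely.\<close>

lemma norm_step_le:
  assumes "norm u = 1" "t \<in> \<Theta>"
  shows "norm (step x u) \<le> norm x + \<alpha> * (real CARD('n) * L + (norm x + norm t) / \<xi>)"
proof -
  have "norm (x - proj x) \<le> norm (x - t)"
    using closest_point_le[OF \<Theta>(1) assms(2), of x] by (simp add: dist_norm)
  also have "\<dots> \<le> norm x + norm t" by (rule norm_triangle_ineq4)
  finally have p: "norm (pen_grad x) \<le> (norm x + norm t) / \<xi>"
    using xi by (simp add: pen_grad_def divide_right_mono)
  have "norm (step x u) \<le> norm x + norm (\<alpha> *\<^sub>R (estimate x u + pen_grad x))"
    unfolding step_def by (rule norm_triangle_ineq4)
  also have "\<dots> = norm x + \<alpha> * norm (estimate x u + pen_grad x)"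
    using alpha(1) by simp
  also have "\<dots> \<le> norm x + \<alpha> * (real CARD('n) * L + (norm x + norm t) / \<xi>)"
    using alpha(1) norm_estimate_le[OF assms(1), of x] p
    by (intro add_left_mono mult_left_mono norm_triangle_le add_mono) auto
  finally show ?thesis .
qed

text \<open>The bound may grow with \<open>k\<close> but is uniform over the directions; it provides
  integrability and does not enter the final estimate.\<close>

lemma iterate_bounded: "\<exists>B. \<forall>u. (\<forall>j<k. norm (u j) = 1) \<longrightarrow> norm (iterate x u k) \<le> B"
proof (induction k)
  case 0
  show ?case by auto
next
  case (Suc k)
  then obtain B where B: "\<And>u. \<forall>j<k. norm (u j) = 1 \<Longrightarrow> norm (iterate x u k) \<le> B" by blast
  obtain t where t: "t \<in> \<Theta>" using \<Theta>(2) by blast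
  show ?case
  proof (intro exI allI impI)
    fix u :: "nat \<Rightarrow> real ^ 'n" assume u: "\<forall>j<Suc k. norm (u j) = 1"
    then have b: "norm (iterate x u k) \<le> B" by (intro B) auto
    have "norm (iterate x u (Suc k)) \<le> norm (iterate x u k) + \<alpha> * (real CARD('n) * L + (norm (iterate x u k) + norm t) / \<xi>)"
      using u t by (auto intro: norm_step_le)
    also have "\<dots> \<le> B + \<alpha> * (real CARD('n) * L + (B + norm t) / \<xi>)"
      using alpha(1) xi b by (intro add_mono mult_left_mono divide_right_mono) auto
    finally show "norm (iterate x u (Suc k)) \<le> B + \<alpha> * (real CARD('n) * L + (B + norm t) / \<xi>)" .
  qed
qed

end

section \<open>The random run and the telescoped descent\<close>

locale zeroth_order_run = zeroth_order S \<Theta> L \<xi> \<alpha> + prob_space M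
  for S :: "real ^ 'n::finite \<Rightarrow> real" and \<Theta> L \<xi> \<alpha> and M :: "'w measure" +
  fixes u :: "nat \<Rightarrow> 'w \<Rightarrow> real ^ 'n" and K :: nat and x0 :: "real ^ 'n"
  assumes indep: "indep_vars (\<lambda>_. borel) u {..<K}"
    and uniform: "k < K \<Longrightarrow> distr M borel (u k) = uniform_sphere"
begin

abbreviation "it k \<omega> \<equiv> iterate x0 (\<lambda>j. u j \<omega>) k"

lemma u_measurable: "k < K \<Longrightarrow> u k \<in> borel_measurable M"
  using indep by (auto simp: indep_vars_def)

lemma AE_norm_u: "AE \<omega> in M. \<forall>k<K. norm (u k \<omega>) = 1"
proof -
  have "AE \<omega> in M. norm (u k \<omega>) = 1" if k: "k < K" for k
  proof -
    have "AE w in distr M borel (u k). norm w = 1"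
      unfolding uniform[OF k] by (rule AE_uniform_sphere)
    then show ?thesis by (subst (asm) AE_distr_iff) (use u_measurable[OF k] in auto)
  qed
  then have "AE \<omega> in M. \<forall>k\<in>{..<K}. norm (u k \<omega>) = 1"
    by (intro AE_finite_allI) auto
  then show ?thesis by (simp only: Ball_def lessThan_iff)
qed

lemma it_measurable: "k \<le> K \<Longrightarrow> it k \<in> borel_measurable M"
  by (rule iterate_measurable) (use u_measurable in auto)

lemma integrable_it:
  fixes g :: "real ^ 'n \<Rightarrow> real"
  assumes g: "continuous_on UNIV g" and k: "k \<le> K"
  shows "integrable M (\<lambda>\<omega>. g (it k \<omega>))"
proof -
  obtain B where B: "\<And>u. \<forall>j<k. norm (u j) = 1 \<Longrightarrow> norm (iterate x0 u k) \<le> B"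
    using iterate_bounded by blast
  show ?thesis
  proof (rule integrable_continuous_AE_compact[OF g compact_cball _ it_measurable[OF k]])
    show "AE \<omega> in M. it k \<omega> \<in> cball 0 B"
      using AE_norm_u by eventually_elim (use k in \<open>auto intro!: B\<close>)
  qed
qed

text \<open>The iterate is a measurable function of the directions with index below
  \<open>k\<close>, a block disjoint from the index \<open>k\<close> itself.\<close>

lemma indep_it:
  assumes k: "k < K"
  shows "indep_var borel (it k) borel (u k)"
proof -
  have "indep_var (PiM {..<k} (\<lambda>_. borel)) (\<lambda>\<omega>. restrict (\<lambda>i. u i \<omega>) {..<k}) (PiM {k} (\<lambda>_. borel)) (\<lambda>\<omega>. restrict (\<lambda>i. u i \<omega>) {k})"
    by (rule indep_var_restrict[OF indep]) (use k in auto)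
  then have "indep_var borel ((\<lambda>f. iterate x0 f k) \<circ> (\<lambda>\<omega>. restrict (\<lambda>i. u i \<omega>) {..<k})) borel ((\<lambda>f. f k) \<circ> (\<lambda>\<omega>. restrict (\<lambda>i. u i \<omega>) {k}))"
    by (rule indep_var_compose) (auto intro!: iterate_measurable measurable_component_singleton)
  moreover have "iterate x0 (restrict (\<lambda>i. u i \<omega>) {..<k}) k = it k \<omega>" for \<omega>
    by (rule iterate_cong) simp
  ultimately show ?thesis by (simp add: o_def)
qed

text \<open>Integrating out the fresh direction with the current iterate frozen reduces the claim to
  \<open>expected_descent\<close>, averaged over the law of the iterate.\<close>

lemma expectation_descent:
  assumes k: "k < K"
  shows "expectation (\<lambda>\<omega>. obj (it (Suc k) \<omega>)) \<le> expectation (\<lambda>\<omega>. obj (it k \<omega>))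
    - \<alpha> / 2 * expectation (\<lambda>\<omega>. (norm (obj_grad (it k \<omega>)))\<^sup>2) + smoothness * \<alpha>\<^sup>2 * (real CARD('n) * L)\<^sup>2"
proof -
  have int1: "integrable M (\<lambda>\<omega>. obj (step (it k \<omega>) (u k \<omega>)))"
    using integrable_it[OF continuous_obj, of "Suc k"] k by simp
  have meas: "(\<lambda>p. obj (step (fst p) (snd p))) \<in> borel_measurable borel"
    by (intro borel_measurable_continuous_onI continuous_on_compose2[OF continuous_obj continuous_step]) simp
  note iterated = indep_var_expectation_iterated[OF indep_it[OF k] meas int1, unfolded uniform[OF k]]
  have intg: "integrable M (\<lambda>\<omega>. (norm (obj_grad (it k \<omega>)))\<^sup>2)"
    by (rule integrable_it) (use k in \<open>auto intro!: continuous_intros continuous_obj_grad\<close>)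
  have into: "integrable M (\<lambda>\<omega>. obj (it k \<omega>))"
    by (rule integrable_it[OF continuous_obj]) (use k in auto)
  have "expectation (\<lambda>\<omega>. obj (it (Suc k) \<omega>)) = expectation (\<lambda>\<omega>. \<integral>y. obj (step (it k \<omega>) y) \<partial>uniform_sphere)"
    using iterated(1) by simp
  also have "\<dots> \<le> expectation (\<lambda>\<omega>. obj (it k \<omega>) - \<alpha> / 2 * (norm (obj_grad (it k \<omega>)))\<^sup>2 + smoothness * \<alpha>\<^sup>2 * (real CARD('n) * L)\<^sup>2)"
    by (intro integral_mono iterated(2) expected_descent) (use intg into in auto)
  also have "\<dots> = expectation (\<lambda>\<omega>. obj (it k \<omega>))
    - \<alpha> / 2 * expectation (\<lambda>\<omega>. (norm (obj_grad (it k \<omega>)))\<^sup>2) + smoothness * \<alpha>\<^sup>2 * (real CARD('n) * L)\<^sup>2"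
    using intg into prob_space by simp
  finally show ?thesis .
qed

lemma average_gradient_bound:
  assumes lb: "\<And>x. m \<le> obj x" and K: "K \<ge> 1"
  shows "1 / real K * (\<Sum>k<K. expectation (\<lambda>\<omega>. (norm (obj_grad (it k \<omega>)))\<^sup>2))
    \<le> 2 * (obj x0 - m) / (\<alpha> * real K) + 2 * (real CARD('n) * L)\<^sup>2 * smoothness * \<alpha>"
proof -
  let ?g = "\<lambda>k. expectation (\<lambda>\<omega>. (norm (obj_grad (it k \<omega>)))\<^sup>2)"
  let ?c = "smoothness * \<alpha>\<^sup>2 * (real CARD('n) * L)\<^sup>2"
  \<comment> \<open>Telescoped form of the descent: the current expected value plus all decrease so
    far is paid for by the start value and \<open>j\<close> error terms.\<close>
  have "j \<le> K \<Longrightarrow> expectation (\<lambda>\<omega>. obj (it j \<omega>)) + \<alpha> / 2 * (\<Sum>k<j. ?g k) \<le> obj x0 + real j * ?c" for j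
  proof (induction j)
    case 0
    then show ?case using prob_space by simp
  next
    case (Suc j)
    then have "expectation (\<lambda>\<omega>. obj (it j \<omega>)) + \<alpha> / 2 * (\<Sum>k<j. ?g k) \<le> obj x0 + real j * ?c" "j < K" by auto
    with expectation_descent[of j] show ?case by (simp add: algebra_simps del: iterate.simps)
  qed
  from this[of K] have "expectation (\<lambda>\<omega>. obj (it K \<omega>)) + \<alpha> / 2 * (\<Sum>k<K. ?g k) \<le> obj x0 + real K * ?c" by simp
  moreover have "m \<le> expectation (\<lambda>\<omega>. obj (it K \<omega>))"
  proof -
    have "m = expectation (\<lambda>\<omega>. m)" using prob_space by simp
    also have "\<dots> \<le> expectation (\<lambda>\<omega>. obj (it K \<omega>))"
      by (intro integral_mono integrable_it[OF continuous_obj] lb) auto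
    finally show ?thesis .
  qed
  ultimately have "\<alpha> / 2 * (\<Sum>k<K. ?g k) \<le> obj x0 - m + real K * ?c" by linarith
  \<comment> \<open>This factor turns \<alpha> / 2 times the sum into the average, and K error terms
    into 2 / \<alpha> times one of them.\<close>
  then have "2 / (\<alpha> * real K) * (\<alpha> / 2 * (\<Sum>k<K. ?g k)) \<le> 2 / (\<alpha> * real K) * (obj x0 - m + real K * ?c)"
    using alpha(1) by (intro mult_left_mono) auto
  also have "2 / (\<alpha> * real K) * (\<alpha> / 2 * (\<Sum>k<K. ?g k)) = 1 / real K * (\<Sum>k<K. ?g k)"
    using alpha(1) by simp
  also have "2 / (\<alpha> * real K) * (obj x0 - m + real K * ?c) = 2 * (obj x0 - m) / (\<alpha> * real K) + 2 * (real CARD('n) * L)\<^sup>2 * smoothness * \<alpha>"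
    using alpha(1) K by (simp add: distrib_left power2_eq_square)
  finally show ?thesis .
qed

end

section \<open>From the game to a single Lipschitz objective\<close>

theorem corollary2:
  fixes own :: "'d::finite \<Rightarrow> 'p::finite"
    and X :: "'p \<Rightarrow> (real ^ 'd) set"
    and \<Theta> :: "(real ^ 'n::finite) set"
    and f :: "'p \<Rightarrow> real ^ 'd \<Rightarrow> real ^ 'n \<Rightarrow> real"
    and E :: "'p rel" and A :: "real ^ 'p ^ 'p"
    and L_F \<xi> \<alpha> :: real and \<theta>0 :: "real ^ 'n"
    and M :: "'w measure" and u :: "nat \<Rightarrow> 'w \<Rightarrow> real ^ 'n" and K :: nat
  assumes "assumption1 own X \<Theta> f" and "assumption2 own X f" and "assumption3 E A"
    and "L_F > 0"
    and "\<forall>i \<theta> \<theta>'. \<bar>ne_cost own X f i \<theta> - ne_cost own X f i \<theta>'\<bar> \<le> L_F * norm (\<theta> - \<theta>')"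
    and "\<xi> > 0"
    and "\<exists>t. \<forall>\<theta>. penalized_obj \<xi> \<Theta> (ne_cost own X f) t \<le> penalized_obj \<xi> \<Theta> (ne_cost own X f) \<theta>"
    and "\<theta>0 \<in> \<Theta>"
    and "prob_space M"
    and "K \<ge> 1"
    and "prob_space.indep_vars M (\<lambda>_. borel) u {..<K}"
    and "\<forall>k<K. distr M borel (u k) = uniform_sphere"
    and "\<alpha> > 0"
    and "\<alpha> \<le> \<xi> / (2 * (real CARD('n) * real CARD('p) * L_F + 1))"
  defines "\<theta> \<equiv> \<lambda>k \<omega>. zo_iterate \<alpha> \<xi> \<Theta> (ne_cost own X f) \<theta>0 (\<lambda>j. u j \<omega>) k"
    and "FF \<equiv> penalized_obj \<xi> \<Theta> (ne_cost own X f)"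
  shows "(\<forall>k<K. integrable M (\<lambda>\<omega>. (norm (gradient FF (\<theta> k \<omega>)))\<^sup>2)) \<and>
    1 / real K * (\<Sum>k<K. prob_space.expectation M (\<lambda>\<omega>. (norm (gradient FF (\<theta> k \<omega>)))\<^sup>2))
      \<le> 2 * (FF \<theta>0 - (INF t. FF t)) / (\<alpha> * real K)
        + 2 * (real CARD('p))\<^sup>2 * (real CARD('n))\<^sup>2 * L_F\<^sup>2
            * ((real CARD('n) * real CARD('p) * L_F + 1) / \<xi>) * \<alpha>"
proof -
  interpret prob_space M by fact
  let ?F = "ne_cost own X f"
  define S where "S x = (\<Sum>i\<in>UNIV. ?F i x)" for x
  have lip: "\<bar>S x - S y\<bar> \<le> (real CARD('p) * L_F) * norm (x - y)" for x y
  proof -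
    have "\<bar>S x - S y\<bar> \<le> (\<Sum>i\<in>UNIV. \<bar>?F i x - ?F i y\<bar>)"
      unfolding S_def sum_subtractf[symmetric] by (rule sum_abs)
    also have "\<dots> \<le> (\<Sum>i\<in>(UNIV :: 'p set). L_F * norm (x - y))"
      by (intro sum_mono) (use assms(5) in blast)
    finally show ?thesis by simp
  qed
  have \<Theta>: "closed \<Theta>" "\<Theta> \<noteq> {}" "convex \<Theta>"
    using assms(1) unfolding assumption1_def by blast+
  note xi = \<open>\<xi> > 0\<close>
  have alpha: "\<alpha> > 0" "\<alpha> \<le> \<xi> / (2 * (real CARD('n) * (real CARD('p) * L_F) + 1))"
    using assms(13,14) by (simp_all only: mult.assoc)
  have uniform: "distr M borel (u k) = uniform_sphere" if "k < K" for k
    using assms(12) that by blast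
  note indep = \<open>prob_space.indep_vars M (\<lambda>_. borel) u {..<K}\<close>
  interpret zeroth_order_run S \<Theta> "real CARD('p) * L_F" \<xi> \<alpha> M u K \<theta>0
    by (unfold_locales; (fact lip xi alpha \<Theta> indep | rule uniform, assumption))
  have FF: "FF = obj"
  proof
    fix x
    \<comment> \<open>The smoothed objective sums the players' averages, whereas \<open>obj\<close>
      averages their sum; integrability of each summand permits the exchange.\<close>
    have "integrable uniform_ball (\<lambda>v. ?F i (x + \<xi> *\<^sub>R v))" for i
    proof (rule uniform_ball_integrable, rule continuous_on_compose2[of UNIV "?F i"])
      show "continuous_on UNIV (?F i)"
        by (rule lipschitz_on_continuous_on[of L_F]) (use assms(4,5) in \<open>auto simp: lipschitz_on_def dist_norm\<close>)
    qed (auto intro!: continuous_intros)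
    then show "FF x = obj x"
      by (simp add: FF_def penalized_obj_def smoothed_obj_def smoothed_indicator_def obj_def S_def)
  qed
  have zo: "zo_grad \<xi> ?F x w = estimate x w" for x w
    by (simp only: zo_grad_def estimate_def S_def sum_subtractf[symmetric] sum_distrib_left scaleR_sum_left)
  have \<theta>: "\<theta> k \<omega> = it k \<omega>" for k \<omega>
    unfolding \<theta>_def by (induction k) (simp_all add: Let_def zo step_def pen_grad_def)
  obtain t where t: "\<And>x. obj t \<le> obj x"
    using assms(7) unfolding FF_def[symmetric] FF by blast
  \<comment> \<open>The infimum of a set of reals is a lower bound only if the set is bounded below;
    the minimizer supplies such a bound.\<close>
  have "bdd_below (range obj)" using t by (auto simp: bdd_below_def)
  then have inf: "(INF x. obj x) \<le> obj x" for x by (rule cINF_lower) simp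
  have "integrable M (\<lambda>\<omega>. (norm (obj_grad (it k \<omega>)))\<^sup>2)" if "k < K" for k
    by (rule integrable_it) (use that in \<open>auto intro!: continuous_intros continuous_obj_grad\<close>)
  moreover have "2 * (real CARD('n) * (real CARD('p) * L_F))\<^sup>2 * smoothness * \<alpha>
    = 2 * (real CARD('p))\<^sup>2 * (real CARD('n))\<^sup>2 * L_F\<^sup>2
            * ((real CARD('n) * real CARD('p) * L_F + 1) / \<xi>) * \<alpha>"
    unfolding smoothness_def by (simp add: power_mult_distrib mult_ac)
  ultimately show ?thesis
    using average_gradient_bound[OF inf \<open>K \<ge> 1\<close>] by (simp only: FF \<theta> gradient_obj) simp
qed

end
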